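(* Let $A\in\mathbb{H}^n_{\sup}$ and $C\in\mathbb{H}^{r\times n}_{\sup}$, and suppose the following three assumptions hold. (I) For all $c\in\mathcal{M}$ and $\delta>0$, $\mu(\{\phi\in\mathcal{M}:\|\phi-c\|<\delta\})>0$. (II) The functions $A$ and $C$ are continuous on $\mathcal{M}$. (III) There exist $S\in\mathbb{H}^{n+}_{\sup}$, $L\in\mathbb{H}^{n\times r}_{\sup}$ and $\epsilon>0$ such that $$S(\phi)-(A(\phi)+L(\phi)C(\phi))^{\top}\left(\int_{\mathcal{M}}g(\phi,\ell)S(\ell)\mu(d\ell)\right)(A(\phi)+L(\phi)C(\phi))\ge\epsilon I$$ for $\mu$-almost every $\phi\in\mathcal{M}$. Moreover, for every $\epsilon_a,\epsilon_b>0$ there exist disjoint boxes $\{\mathcal{B}_i\}_{i=1}^N$ whose union is $\mathcal{M}$, points $c_i\in\mathcal{B}_i$ $(i=1,\dots,N)$, and piecewise-constant functions $S_a\in\mathbb{H}^{n+}_{\sup}$, $L_a\in\mathbb{H}^{n\times r}_{\sup}$, with $S_a(\phi)=S_i>0$ and $L_a(\phi)=L_i$ for all $\phi\in\mathcal{B}_i$, such that: 1. $\|S-S_a\|_\infty<\epsilon_a$ and $\|L-L_a\|_\infty<\epsilon_a$; 2. for all $i,j=1,\dots,N$, the function $w_j(\phi):=\int_{\mathcal{B}_j}g(\phi,\ell)\mu(d\ell)$ is continuous at $\phi=c_i$; 3. for every $i=1,\dots,N$ and $\mu$-almost every $\phi\in\mathcal{B}_i$, $$\left\|\begin{bmatrix}A(\phi)\\C(\phi)\end{bmatrix}-\begin{bmatrix}A(c_i)\\C(c_i)\end{bmatrix}\right\|<\epsilon_b,$$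 $$\left\|\begin{bmatrix}\sqrt{w_1(\phi)}&\cdots&\sqrt{w_N(\phi)}\end{bmatrix}-\begin{bmatrix}\sqrt{w_1(c_i)}&\cdots&\sqrt{w_N(c_i)}\end{bmatrix}\right\|<\epsilon_b.$$ Then there exist disjoint boxes $\{\mathcal{B}_i\}_{i=1}^N$ whose union is $\mathcal{M}$, points $c_i\in\mathcal{B}_i$ and scalars $\kappa_{A,i},\kappa_{w,i}>0$ $(i=1,\dots,N)$ such that, with $w_j(\phi):=\int_{\mathcal{B}_j}g(\phi,\ell)\mu(d\ell)$, $\Upsilon_{A,i}:=A(c_i)$, $\Upsilon_{C,i}:=C(c_i)$ and $\Upsilon_{w,i}:=\begin{bmatrix}\sqrt{w_1(c_i)}I&\cdots&\sqrt{w_N(c_i)}I\end{bmatrix}$ ($I$ the $n\times n$ identity), one has $$\left\|\begin{bmatrix}A(\phi)\\C(\phi)\end{bmatrix}-\begin{bmatrix}\Upsilon_{A,i}\\\Upsilon_{C,i}\end{bmatrix}\right\|\le\kappa_{A,i},\qquad\left\|\begin{bmatrix}\sqrt{w_1(\phi)}I&\cdots&\sqrt{w_N(\phi)}I\end{bmatrix}-\Upsilon_{w,i}\right\|\le\kappa_{w,i}$$ for $\mu$-almost every $\phi\in\mathcal{B}_i$ and all $i=1,\dots,N$, and the linear matrix inequalities $$\begin{bmatrix}U_i+U_i^{\top}&0&U_i\Upsilon_{A,i}+\bar L_i\Upsilon_{C,i}&\kappa_{A,i}\begin{bmatrix}U_i&\bar L_i\end{bmatrix}&0&\Upsilon_{w,i}\bm{S}&\rho_iI\\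 \star&\lambda_iI&\lambda_iI&0&0&0&0\\ \star&\star&S_i&0&0&0&0\\ \star&\star&\star&\lambda_iI&0&0&0\\ \star&\star&\star&\star&\rho_iI&\kappa_{w,i}\bm{S}&0\\ \star&\star&\star&\star&\star&\bm{S}&0\\ \star&\star&\star&\star&\star&\star&\rho_iI\end{bmatrix}>0,\qquad i=1,\dots,N,\quad\bm{S}:=\mathrm{diag}(S_1,\dots,S_N),$$ are feasible, i.e. are satisfied by some positive definite $S_i\in\mathbb{R}^{n\times n}$, matrices $U_i\in\mathbb{R}^{n\times n}$, $\bar L_i\in\mathbb{R}^{n\times r}$, and scalars $\lambda_i,\rho_i>0$.
   Context: $\mathcal{M}=[\tau_{\min},\tau_{\max}]^p\subset\mathbb{R}^p$, with its Borel $\sigma$-algebra and a $\sigma$-finite measure $\mu$. $g(\cdot,\cdot)$ is the transition density with respect to $\mu$ of a time-homogeneous Markov chain $\{\phi_k\}$ in $\mathcal{M}$: $P(\phi_{k+1}\in\mathcal{B}\mid\phi_k=\phi)=\int_{\mathcal{B}}g(\phi,\ell)\mu(d\ell)$ for all Borel $\mathcal{B}\subset\mathcal{M}$; in particular $\int_{\mathcal{M}}g(\phi,\ell)\mu(d\ell)=1$. A box is a product of $p$ intervals. $\mathbb{H}^{n\times m}_{\sup}$ is the space of measurable, essentially bounded functions $\mathcal{M}\to\mathbb{R}^{n\times m}$; $\mathbb{H}^n_{\sup}:=\mathbb{H}^{n\times n}_{\sup}$; $\mathbb{H}^{n+}_{\sup}$ is the set of $P\in\mathbb{H}^n_{\sup}$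 with $P(\phi)\ge0$ (symmetric positive semidefinite) for $\mu$-almost every $\phi$. $\|P\|_\infty$ is the $\mu$-essential supremum of $\|P(\cdot)\|$, where $\|\cdot\|$ is the Euclidean norm for vectors and the induced norm for matrices. $\star$ denotes blocks determined by symmetry; $>0$ means symmetric positive definite. Block sizes in the inequality are $n,n,n,n+r,nN,nN,n$. *)

theory Defs
  imports "HOL-Probability.Probability"
begin

definition is_product_box :: "(real^'p) set \<Rightarrow> bool" where
  "is_product_box B \<longleftrightarrow>
     (\<exists>J :: 'p \<Rightarrow> real set. (\<forall>k. is_interval (J k)) \<and> B = {x. \<forall>k. x $ k \<in> J k})"

definition box_partition :: "(real^'p) set \<Rightarrow> nat \<Rightarrow> (nat \<Rightarrow> (real^'p) set) \<Rightarrow> bool" where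
  "box_partition M N B \<longleftrightarrow>
     (\<forall>i<N. is_product_box (B i)) \<and> disjoint_family_on B {..<N} \<and> (\<Union>i<N. B i) = M"

text \<open>
  \<open>g\<close> is a transition density with respect to \<open>\<mu>\<close>: there is a Markov kernel \<open>K\<close>, the one-step
  transition law of the chain, with \<open>K x B\<close> the integral of \<open>g x\<close> over \<open>B\<close> for every measurable
  \<open>B\<close>. Unit mass of \<open>g x\<close> is the case \<open>B = space \<mu>\<close>; nonnegativity almost everywhere also follows.
\<close>

definition transition_density :: "'a measure \<Rightarrow> ('a \<Rightarrow> 'a \<Rightarrow> real) \<Rightarrow> bool" where
  "transition_density \<mu> g \<longleftrightarrow>
     (\<exists>K. K \<in> \<mu> \<rightarrow>\<^sub>M prob_algebra \<mu> \<and>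
        (\<forall>x\<in>space \<mu>. integrable \<mu> (g x) \<and>
           (\<forall>B\<in>sets \<mu>. measure (K x) B = (LINT l:B|\<mu>. g x l))))"

definition cell_weight ::
    "'a measure \<Rightarrow> ('a \<Rightarrow> 'a \<Rightarrow> real) \<Rightarrow> (nat \<Rightarrow> 'a set) \<Rightarrow> nat \<Rightarrow> 'a \<Rightarrow> real" where
  "cell_weight \<mu> g B j x = (LINT l:B j|\<mu>. g x l)"


text \<open>The norm of the type \<open>real^'m^'n\<close> is the Frobenius norm, so the induced norm is spelled out.\<close>

definition opnorm :: "real^'m^'n \<Rightarrow> real" where
  "opnorm X = onorm (\<lambda>v. X *v v)"

definition psd :: "real^'n^'n \<Rightarrow> bool" where
  "psd X \<longleftrightarrow> transpose X = X \<and> (\<forall>v. 0 \<le> v \<bullet> (X *v v))"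

definition pos_def :: "real^'n^'n \<Rightarrow> bool" where
  "pos_def X \<longleftrightarrow> transpose X = X \<and> (\<forall>v. v \<noteq> 0 \<longrightarrow> 0 < v \<bullet> (X *v v))"

definition vstack :: "real^'m^'n \<Rightarrow> real^'m^'r \<Rightarrow> real^'m^('n + 'r)" where
  "vstack X Y = (\<chi> k. case k of Inl a \<Rightarrow> X $ a | Inr b \<Rightarrow> Y $ b)"

definition hstack :: "real^'n^'k \<Rightarrow> real^'r^'k \<Rightarrow> real^('n + 'r)^'k" where
  "hstack X Y = (\<chi> i k. case k of Inl a \<Rightarrow> X $ i $ a | Inr b \<Rightarrow> Y $ i $ b)"

definition sup_norm :: "'a measure \<Rightarrow> ('a \<Rightarrow> real^'m^'n) \<Rightarrow> ereal" where
  "sup_norm \<mu> P = esssup \<mu> (\<lambda>x. ereal (opnorm (P x)))"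

definition H_sup :: "'a measure \<Rightarrow> ('a \<Rightarrow> real^'m^'n) set" where
  "H_sup \<mu> = {P. P \<in> borel_measurable \<mu> \<and> sup_norm \<mu> P < \<infinity>}"

definition H_sup_psd :: "'a measure \<Rightarrow> ('a \<Rightarrow> real^'n^'n) set" where
  "H_sup_psd \<mu> = {P \<in> H_sup \<mu>. AE x in \<mu>. psd (P x)}"


text \<open>
  Matrices whose size depends on the number \<open>N\<close> of boxes cannot have a type as index set. They are
  functions of two indices, restricted to explicit finite index sets.
\<close>

definition ix_opnorm :: "'i set \<Rightarrow> 'j set \<Rightarrow> ('i \<Rightarrow> 'j \<Rightarrow> real) \<Rightarrow> real" where
  "ix_opnorm I J X = (SUP v\<in>{v. L2_set v J \<le> 1}. L2_set (\<lambda>i. \<Sum>j\<in>J. X i j * v j) I)"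

definition ix_mult :: "'j set \<Rightarrow> ('i \<Rightarrow> 'j \<Rightarrow> real) \<Rightarrow> ('j \<Rightarrow> 'k \<Rightarrow> real) \<Rightarrow> 'i \<Rightarrow> 'k \<Rightarrow> real" where
  "ix_mult J X Y = (\<lambda>i k. \<Sum>j\<in>J. X i j * Y j k)"

definition ix_pos_def :: "'i set \<Rightarrow> ('i \<Rightarrow> 'i \<Rightarrow> real) \<Rightarrow> bool" where
  "ix_pos_def I X \<longleftrightarrow> (\<forall>i\<in>I. \<forall>j\<in>I. X i j = X j i) \<and>
     (\<forall>v. (\<exists>i\<in>I. v i \<noteq> 0) \<longrightarrow> 0 < (\<Sum>i\<in>I. \<Sum>j\<in>I. v i * X i j * v j))"

text \<open>Index \<open>(j, a)\<close> is position \<open>a\<close> within the \<open>j\<close>-th of \<open>N\<close> consecutive blocks of size \<open>n\<close>.\<close>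

definition stacked :: "nat \<Rightarrow> (nat \<times> 'n) set" where
  "stacked N = {..<N} \<times> UNIV"

definition sqrt_weight_row :: "(nat \<Rightarrow> 'a \<Rightarrow> real) \<Rightarrow> 'a \<Rightarrow> 'n \<Rightarrow> nat \<times> 'n \<Rightarrow> real" where
  "sqrt_weight_row w x = (\<lambda>a (j, b). if a = b then sqrt (w j x) else 0)"

definition block_diag :: "(nat \<Rightarrow> real^'n^'n) \<Rightarrow> nat \<times> 'n \<Rightarrow> nat \<times> 'n \<Rightarrow> real" where
  "block_diag S = (\<lambda>(j, a) (k, b). if j = k then S j $ a $ b else 0)"

text \<open>Row and column indices of the linear matrix inequality, one constructor for each block.\<close>

datatype ('n, 'r) lmi_index =
    B1 'n | B2 'n | B3 'n | B4 "'n + 'r" | B5 "nat \<times> 'n" | B6 "nat \<times> 'n" | B7 'n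

primrec block_no :: "('n, 'r) lmi_index \<Rightarrow> nat" where
  "block_no (B1 _) = 1"
| "block_no (B2 _) = 2"
| "block_no (B3 _) = 3"
| "block_no (B4 _) = 4"
| "block_no (B5 _) = 5"
| "block_no (B6 _) = 6"
| "block_no (B7 _) = 7"

definition lmi_indices :: "nat \<Rightarrow> ('n, 'r) lmi_index set" where
  "lmi_indices N = range B1 \<union> range B2 \<union> range B3 \<union> range B4 \<union>
     B5 ` stacked N \<union> B6 ` stacked N \<union> range B7"

text \<open>
  The blocks on and above the diagonal. \<open>mat k\<close> is \<open>k\<close> times the identity, \<open>Sd\<close> is the
  \<open>(3,3)\<close> block and \<open>S\<close> the family forming the block diagonal matrix.
\<close>

definition lmi_upper :: "nat \<Rightarrow> real^'n^'n \<Rightarrow> real^'n^'r \<Rightarrow> ('n \<Rightarrow> nat \<times> 'n \<Rightarrow> real) \<Rightarrow> real \<Rightarrow> real \<Rightarrow>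
    (nat \<Rightarrow> real^'n^'n) \<Rightarrow> real^'n^'n \<Rightarrow> real^'n^'n \<Rightarrow> real^'r^'n \<Rightarrow> real \<Rightarrow> real \<Rightarrow>
    ('n, 'r) lmi_index \<Rightarrow> ('n, 'r) lmi_index \<Rightarrow> real" where
  "lmi_upper N YA YC Yw kA kw S Sd U L lam rho s t =
     (case s of
        B1 a \<Rightarrow> (case t of
            B1 b \<Rightarrow> (U + transpose U) $ a $ b
          | B2 b \<Rightarrow> 0
          | B3 b \<Rightarrow> (U ** YA + L ** YC) $ a $ b
          | B4 b \<Rightarrow> (kA *\<^sub>R hstack U L) $ a $ b
          | B5 b \<Rightarrow> 0
          | B6 b \<Rightarrow> ix_mult (stacked N) Yw (block_diag S) a b
          | B7 b \<Rightarrow> mat rho $ a $ b)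
      | B2 a \<Rightarrow> (case t of B2 b \<Rightarrow> mat lam $ a $ b | B3 b \<Rightarrow> mat lam $ a $ b | _ \<Rightarrow> 0)
      | B3 a \<Rightarrow> (case t of B3 b \<Rightarrow> Sd $ a $ b | _ \<Rightarrow> 0)
      | B4 a \<Rightarrow> (case t of B4 b \<Rightarrow> mat lam $ a $ b | _ \<Rightarrow> 0)
      | B5 a \<Rightarrow> (case t of
            B5 b \<Rightarrow> (if a = b then rho else 0) | B6 b \<Rightarrow> kw * block_diag S a b | _ \<Rightarrow> 0)
      | B6 a \<Rightarrow> (case t of B6 b \<Rightarrow> block_diag S a b | _ \<Rightarrow> 0)
      | B7 a \<Rightarrow> (case t of B7 b \<Rightarrow> mat rho $ a $ b | _ \<Rightarrow> 0))"

definition lmi_matrix :: "nat \<Rightarrow> real^'n^'n \<Rightarrow> real^'n^'r \<Rightarrow> ('n \<Rightarrow> nat \<times> 'n \<Rightarrow> real) \<Rightarrow> real \<Rightarrow> real \<Rightarrow>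
    (nat \<Rightarrow> real^'n^'n) \<Rightarrow> real^'n^'n \<Rightarrow> real^'n^'n \<Rightarrow> real^'r^'n \<Rightarrow> real \<Rightarrow> real \<Rightarrow>
    ('n, 'r) lmi_index \<Rightarrow> ('n, 'r) lmi_index \<Rightarrow> real" where
  "lmi_matrix N YA YC Yw kA kw S Sd U L lam rho s t =
     (if block_no s \<le> block_no t then lmi_upper N YA YC Yw kA kw S Sd U L lam rho s t
      else lmi_upper N YA YC Yw kA kw S Sd U L lam rho t s)"

end

theory Submission
  imports Defs
begin

text \<open>
  Fix the solution \<open>S\<close>, \<open>L\<close>, \<open>\<epsilon>\<close> of the decay inequality, put one small number \<open>\<eta>\<close> for both
  \<open>\<epsilon>a\<close> and \<open>\<epsilon>b\<close>, and take the resulting boxes with \<open>\<kappa>A i = \<kappa>w i = \<eta>\<close>. The bounds by \<open>\<kappa>A\<close> and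
  \<open>\<kappa>w\<close> then come with the boxes, because the matrix made of the blocks \<open>d j\<close> times the identity has
  induced norm at most the Euclidean norm of \<open>d\<close> (lemma \<open>sqrt_weight_row_opnorm\<close>). What has to be
  proved is that the matrix inequalities are feasible when \<open>\<eta>\<close> is small compared with constants that
  do not depend on the partition.

  At a sample point \<open>c i\<close> write \<open>G = A (c i) + L i ** C (c i)\<close> and let \<open>W\<close> be the sum of the
  \<open>w j (c i) *\<^sub>R S j\<close>. The inequality needed there is
  \<open>S i - transpose G ** W ** G \<ge> \<epsilon> / 2\<close>. The hypothesis gives an inequality of this kind only almost
  everywhere, hence not necessarily at \<open>c i\<close>. There are two cases.

  If the box \<open>B i\<close> has positive measure, it contains a point \<open>\<phi>\<close> at which all the almost sure
  hypotheses hold, and each of the passages from \<open>\<phi>\<close> to \<open>c i\<close>, from \<open>S\<close>, \<open>L\<close> to their piecewise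
  constant approximations, and from the integral to \<open>W\<close> costs \<open>O(\<eta>)\<close> (lemma \<open>cell_decay\<close>). The
  weights have total mass one, so by Cauchy and Schwarz their total variation is at most twice the
  distance of the vectors of their square roots (lemma \<open>cell_weight_L1_le\<close>).

  If \<open>B i\<close> is a null set, the matrix attached to it need not satisfy any decay inequality. But then
  \<open>w i\<close> vanishes identically, so \<open>S i\<close> enters no other decay inequality and can be replaced by a
  large multiple of the identity, with gain \<open>0\<close>. How large it must be is bounded in advance, since
  \<open>A\<close> is continuous on a compact set. This matters: through the block diagonal matrix \<open>S i\<close> occurs in
  every matrix inequality, multiplied by \<open>\<kappa>w\<close>, so \<open>\<eta>\<close> has to be small compared with it.

  It remains to solve the matrix inequality (lemma \<open>lmi_pos_def\<close>). Take \<open>U = W + \<beta> I\<close> and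
  \<open>U ** L i\<close> for the transformed gain. Completing squares, first in the variables of blocks six,
  seven and two, and then using \<open>(x1 + G x3) \<bullet> U (x1 + G x3) \<ge> 0\<close>, leaves positive multiples of
  \<open>x1 \<bullet> x1\<close>, \<open>x3 \<bullet> x3\<close>, \<open>x4 \<bullet> x4\<close> and the \<open>x5 j \<bullet> x5 j\<close>: the slack \<open>\<beta> x1 \<bullet> x1\<close> absorbs all terms in
  \<open>x1\<close>, and the decay inequality controls \<open>x3\<close>.
\<close>

section \<open>The quadratic form of the linear matrix inequality\<close>

lemma sum_sym_Un:
  fixes F :: "'a \<Rightarrow> 'a \<Rightarrow> real"
  assumes "finite X" "finite Y" "X \<inter> Y = {}"
    and "\<And>s t. s \<in> X \<Longrightarrow> t \<in> Y \<Longrightarrow> F t s = F s t"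
  shows "(\<Sum>s\<in>X \<union> Y. \<Sum>t\<in>X \<union> Y. F s t)
       = (\<Sum>s\<in>X. \<Sum>t\<in>X. F s t) + 2 * (\<Sum>s\<in>X. \<Sum>t\<in>Y. F s t) + (\<Sum>s\<in>Y. \<Sum>t\<in>Y. F s t)"
proof -
  have "(\<Sum>s\<in>Y. \<Sum>t\<in>X. F s t) = (\<Sum>s\<in>X. \<Sum>t\<in>Y. F s t)"
    using assms by (subst sum.swap) (auto intro!: sum.cong)
  then show ?thesis
    using assms by (simp add: sum.union_disjoint sum.distrib)
qed

lemma finite_stacked [simp]: "finite (stacked N :: (nat \<times> 'n::finite) set)"
  by (simp add: stacked_def)

lemma lmi_indices_split:
  "lmi_indices N = range B1 \<union> (range B2 \<union> (range B3 \<union> (range B4 \<union>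
     (B5 ` stacked N \<union> (B6 ` stacked N \<union> range B7)))))"
  by (auto simp: lmi_indices_def)

lemma sum_stacked: "(\<Sum>p\<in>stacked N. f p) = (\<Sum>j<N. \<Sum>a\<in>UNIV. f (j, a :: 'n::finite))"
  by (simp add: stacked_def sum.cartesian_product)

lemma lmi_sum_image:
  "sum f (range B1) = (\<Sum>a\<in>UNIV. f (B1 (a::'n::finite)))"
  "sum f (range B2) = (\<Sum>a\<in>UNIV. f (B2 (a::'n::finite)))"
  "sum f (range B3) = (\<Sum>a\<in>UNIV. f (B3 (a::'n::finite)))"
  "sum f (range B4) = (\<Sum>k\<in>UNIV. f (B4 (k::'n::finite + 'r::finite)))"
  "sum f (B5 ` stacked N) = (\<Sum>j<N. \<Sum>a\<in>UNIV. f (B5 (j, a::'n)))"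
  "sum f (B6 ` stacked N) = (\<Sum>j<N. \<Sum>a\<in>UNIV. f (B6 (j, a::'n)))"
  "sum f (range B7) = (\<Sum>a\<in>UNIV. f (B7 (a::'n::finite)))"
  by (subst sum.reindex; simp add: inj_on_def sum_stacked o_def)+

lemma inner_matrix_sum:
  "x \<bullet> (X *v y) = (\<Sum>a\<in>UNIV. \<Sum>b\<in>UNIV. x $ a * X $ a $ b * y $ b)"
  by (simp add: inner_vec_def matrix_vector_mult_def sum_distrib_left mult.assoc)

lemma mat_component: "mat k $ a $ b = (if a = b then k else 0)"
  by (simp add: mat_def)

lemma lmi_matrix_simps:
  "block_no s < block_no t \<Longrightarrow> lmi_matrix N YA YC Yw kA kw S Sd U L lam rho s t = lmi_upper N YA YC Yw kA kw S Sd U L lam rho s t"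
  "block_no s < block_no t \<Longrightarrow> lmi_matrix N YA YC Yw kA kw S Sd U L lam rho t s = lmi_upper N YA YC Yw kA kw S Sd U L lam rho s t"
  "block_no s = block_no t \<Longrightarrow> lmi_matrix N YA YC Yw kA kw S Sd U L lam rho s t = lmi_upper N YA YC Yw kA kw S Sd U L lam rho s t"
  by (simp_all add: lmi_matrix_def)

lemma weight_row_mult_block_diag:
  assumes "j < N"
  shows "ix_mult (stacked N) (sqrt_weight_row w c) (block_diag S) a (j, b) = sqrt (w j c) * S j $ a $ b"
proof -
  have "(\<Sum>k<N. \<Sum>d\<in>UNIV. (if a = d then sqrt (w k c) else 0) * (if k = j then S k $ d $ b else 0))
     = (\<Sum>k<N. if k = j then sqrt (w j c) * S j $ a $ b else 0)"
    by (intro sum.cong refl) (auto simp: if_distrib[of "\<lambda>x. x * _"] cong: if_cong)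
  then show ?thesis
    using assms by (simp add: ix_mult_def sum_stacked sqrt_weight_row_def block_diag_def sum.delta)
qed

text \<open>
  The quadratic form written block by block. Only the blocks on and above the diagonal are given
  explicitly, so each strictly upper block contributes twice, and splitting the index set one block
  at a time never meets a lower block.
\<close>

lemma lmi_form:
  fixes v :: "('n::finite, 'r::finite) lmi_index \<Rightarrow> real" and S :: "nat \<Rightarrow> real^'n^'n"
    and x5 x6 :: "nat \<Rightarrow> real^'n"
  defines "x1 \<equiv> \<chi> a. v (B1 a)" and "x2 \<equiv> \<chi> a. v (B2 a)" and "x3 \<equiv> \<chi> a. v (B3 a)"
    and "x4 \<equiv> \<chi> k. v (B4 k)" and "x5 \<equiv> \<lambda>j. \<chi> a. v (B5 (j, a))" and "x6 \<equiv> \<lambda>j. \<chi> a. v (B6 (j, a))"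
    and "x7 \<equiv> \<chi> a. v (B7 a)"
  shows "(\<Sum>s\<in>lmi_indices N. \<Sum>t\<in>lmi_indices N.
      v s * lmi_matrix N YA YC (sqrt_weight_row w c) kA kw S Sd U L lam rho s t * v t) =
    x1 \<bullet> ((U + transpose U) *v x1) + 2 * (x1 \<bullet> ((U ** YA + L ** YC) *v x3))
      + 2 * kA * (x1 \<bullet> (hstack U L *v x4))
      + 2 * (\<Sum>j<N. sqrt (w j c) * (x1 \<bullet> (S j *v x6 j))) + 2 * rho * (x1 \<bullet> x7)
    + lam * (x2 \<bullet> x2) + 2 * lam * (x2 \<bullet> x3) + x3 \<bullet> (Sd *v x3) + lam * (x4 \<bullet> x4)
    + (\<Sum>j<N. rho * (x5 j \<bullet> x5 j)) + 2 * kw * (\<Sum>j<N. x5 j \<bullet> (S j *v x6 j))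
    + (\<Sum>j<N. x6 j \<bullet> (S j *v x6 j)) + rho * (x7 \<bullet> x7)"
proof -
  \<comment> \<open>The summand as an opaque function, so that the block decomposition does not unfold the entries.\<close>
  define F where "F s t = v s * lmi_matrix N YA YC (sqrt_weight_row w c) kA kw S Sd U L lam rho s t * v t" for s t
  have F_swap: "F t s = F s t" if "block_no s < block_no t" for s t
    using that by (simp add: F_def lmi_matrix_simps)
  have zero: "F (B1 a) (B2 b) = 0" "F (B1 a) (B5 p) = 0" "F (B2 a) (B4 k) = 0" "F (B2 a) (B5 p) = 0"
    "F (B2 a) (B6 p) = 0" "F (B2 a) (B7 b) = 0" "F (B3 a) (B4 k) = 0" "F (B3 a) (B5 p) = 0"
    "F (B3 a) (B6 p) = 0" "F (B3 a) (B7 b) = 0" "F (B4 k) (B5 p) = 0" "F (B4 k) (B6 p) = 0"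
    "F (B4 k) (B7 b) = 0" "F (B5 p) (B7 b) = 0" "F (B6 p) (B7 b) = 0" for a b p k
    by (simp_all add: F_def lmi_matrix_simps lmi_upper_def)
  have blk: "(\<Sum>a\<in>UNIV. \<Sum>b\<in>UNIV. F (B1 a) (B1 b)) = x1 \<bullet> ((U + transpose U) *v x1)"
    "(\<Sum>a\<in>UNIV. \<Sum>b\<in>UNIV. F (B1 a) (B3 b)) = x1 \<bullet> ((U ** YA + L ** YC) *v x3)"
    "(\<Sum>a\<in>UNIV. \<Sum>b\<in>UNIV. F (B1 a) (B4 b)) = kA * (x1 \<bullet> (hstack U L *v x4))"
    "(\<Sum>a\<in>UNIV. \<Sum>b\<in>UNIV. F (B1 a) (B7 b)) = rho * (x1 \<bullet> x7)"
    "(\<Sum>a\<in>UNIV. \<Sum>b\<in>UNIV. F (B2 a) (B2 b)) = lam * (x2 \<bullet> x2)"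
    "(\<Sum>a\<in>UNIV. \<Sum>b\<in>UNIV. F (B2 a) (B3 b)) = lam * (x2 \<bullet> x3)"
    "(\<Sum>a\<in>UNIV. \<Sum>b\<in>UNIV. F (B3 a) (B3 b)) = x3 \<bullet> (Sd *v x3)"
    "(\<Sum>a\<in>UNIV. \<Sum>b\<in>UNIV. F (B4 a) (B4 b)) = lam * (x4 \<bullet> x4)"
    "(\<Sum>a\<in>UNIV. \<Sum>b\<in>UNIV. F (B7 a) (B7 b)) = rho * (x7 \<bullet> x7)"
    by (simp_all add: F_def lmi_matrix_simps lmi_upper_def inner_matrix_sum x1_def x2_def x3_def x4_def
        x7_def mat_component inner_vec_def matrix_vector_mult_def sum_distrib_left if_distrib[of "\<lambda>x. _ * x"]
        if_distrib[of "\<lambda>x. x * _"] ac_simps cong: if_cong)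
  have b16: "(\<Sum>a\<in>UNIV. \<Sum>j<N. \<Sum>b\<in>UNIV. F (B1 a) (B6 (j, b)))
     = (\<Sum>j<N. sqrt (w j c) * (x1 \<bullet> (S j *v x6 j)))"
    apply (subst sum.swap[where B = "{..<N}"])
    apply (rule sum.cong[OF refl])
    apply (simp add: F_def lmi_matrix_simps lmi_upper_def inner_matrix_sum x1_def x6_def
        weight_row_mult_block_diag sum_distrib_left ac_simps)
    done
  \<comment> \<open>Sums over two stacked indices collapse, since the blocks involved are block diagonal.\<close>
  have diag: "(\<Sum>a\<in>UNIV. \<Sum>k<N. \<Sum>b\<in>UNIV. if j = k then f a b else 0) = (\<Sum>a\<in>UNIV. \<Sum>b\<in>UNIV. f a b)"
    if "j < N" for j and f :: "'n \<Rightarrow> 'n \<Rightarrow> real"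
  proof -
    have "(\<Sum>k<N. \<Sum>b\<in>UNIV. if j = k then f a b else 0) = (\<Sum>k<N. if j = k then (\<Sum>b\<in>UNIV. f a b) else 0)" for a
      by (intro sum.cong) auto
    then show ?thesis using that by simp
  qed
  have b56: "(\<Sum>j<N. \<Sum>a\<in>UNIV. \<Sum>k<N. \<Sum>b\<in>UNIV. F (B5 (j, a)) (B6 (k, b)))
     = kw * (\<Sum>j<N. x5 j \<bullet> (S j *v x6 j))"
    unfolding sum_distrib_left
  proof (rule sum.cong[OF refl])
    fix j assume "j \<in> {..<N}"
    then show "(\<Sum>a\<in>UNIV. \<Sum>k<N. \<Sum>b\<in>UNIV. F (B5 (j, a)) (B6 (k, b))) = kw * (x5 j \<bullet> (S j *v x6 j))"
      using diag[of j "\<lambda>a b. kw * (x5 j $ a * S j $ a $ b * x6 j $ b)"]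
      by (simp add: F_def lmi_matrix_simps lmi_upper_def inner_matrix_sum x5_def x6_def block_diag_def
         sum_distrib_left ac_simps if_distrib[of "\<lambda>x. _ * x"] cong: if_cong)
  qed
  have b66: "(\<Sum>j<N. \<Sum>a\<in>UNIV. \<Sum>k<N. \<Sum>b\<in>UNIV. F (B6 (j, a)) (B6 (k, b)))
     = (\<Sum>j<N. x6 j \<bullet> (S j *v x6 j))"
  proof (rule sum.cong[OF refl])
    fix j assume "j \<in> {..<N}"
    then show "(\<Sum>a\<in>UNIV. \<Sum>k<N. \<Sum>b\<in>UNIV. F (B6 (j, a)) (B6 (k, b))) = x6 j \<bullet> (S j *v x6 j)"
      using diag[of j "\<lambda>a b. x6 j $ a * S j $ a $ b * x6 j $ b"]
      by (simp add: F_def lmi_matrix_simps lmi_upper_def inner_matrix_sum x6_def block_diag_def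
         sum_distrib_left ac_simps if_distrib[of "\<lambda>x. _ * x"] cong: if_cong)
  qed
  have b55: "(\<Sum>j<N. \<Sum>a\<in>UNIV. \<Sum>k<N. \<Sum>b\<in>UNIV. F (B5 (j, a)) (B5 (k, b)))
     = (\<Sum>j<N. rho * (x5 j \<bullet> x5 j))"
  proof (rule sum.cong[OF refl])
    fix j assume j: "j \<in> {..<N}"
    have "(\<Sum>a\<in>UNIV. \<Sum>k<N. \<Sum>b\<in>UNIV. F (B5 (j, a)) (B5 (k, b))) =
      (\<Sum>a\<in>UNIV. \<Sum>k<N. \<Sum>b\<in>UNIV. if j = k then if a = b then rho * (x5 j $ a * x5 j $ b) else 0 else 0)"
      by (intro sum.cong refl) (simp add: F_def lmi_matrix_simps lmi_upper_def x5_def)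
    also have "\<dots> = rho * (x5 j \<bullet> x5 j)"
      using j by (subst diag) (simp_all add: inner_vec_def sum_distrib_left)
    finally show "(\<Sum>a\<in>UNIV. \<Sum>k<N. \<Sum>b\<in>UNIV. F (B5 (j, a)) (B5 (k, b))) = rho * (x5 j \<bullet> x5 j)" .
  qed
  have "(\<Sum>s\<in>lmi_indices N. \<Sum>t\<in>lmi_indices N. F s t) =
      (\<Sum>s\<in>range B1. \<Sum>t\<in>range B1. F s t) + 2 * (\<Sum>s\<in>range B1. \<Sum>t\<in>range B2 \<union> (range B3 \<union> (range B4 \<union>
     (B5 ` stacked N \<union> (B6 ` stacked N \<union> range B7)))). F s t)
    + ((\<Sum>s\<in>range B2. \<Sum>t\<in>range B2. F s t) + 2 * (\<Sum>s\<in>range B2. \<Sum>t\<in>range B3 \<union> (range B4 \<union>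
     (B5 ` stacked N \<union> (B6 ` stacked N \<union> range B7))). F s t)
    + ((\<Sum>s\<in>range B3. \<Sum>t\<in>range B3. F s t) + 2 * (\<Sum>s\<in>range B3. \<Sum>t\<in>range B4 \<union>
     (B5 ` stacked N \<union> (B6 ` stacked N \<union> range B7)). F s t)
    + ((\<Sum>s\<in>range B4. \<Sum>t\<in>range B4. F s t) + 2 * (\<Sum>s\<in>range B4. \<Sum>t\<in>
     B5 ` stacked N \<union> (B6 ` stacked N \<union> range B7). F s t)
    + ((\<Sum>s\<in>B5 ` stacked N. \<Sum>t\<in>B5 ` stacked N. F s t)
       + 2 * (\<Sum>s\<in>B5 ` stacked N. \<Sum>t\<in>B6 ` stacked N \<union> range B7. F s t)
    + ((\<Sum>s\<in>B6 ` stacked N. \<Sum>t\<in>B6 ` stacked N. F s t) + 2 * (\<Sum>s\<in>B6 ` stacked N. \<Sum>t\<in>range B7. F s t)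
    + (\<Sum>s\<in>range B7. \<Sum>t\<in>range B7. F s t))))))"
    unfolding lmi_indices_split
    by (subst sum_sym_Un, (auto intro!: F_swap)[4])+ simp
  also have "\<dots> = x1 \<bullet> ((U + transpose U) *v x1) + 2 * (x1 \<bullet> ((U ** YA + L ** YC) *v x3))
      + 2 * kA * (x1 \<bullet> (hstack U L *v x4))
      + 2 * (\<Sum>j<N. sqrt (w j c) * (x1 \<bullet> (S j *v x6 j))) + 2 * rho * (x1 \<bullet> x7)
    + lam * (x2 \<bullet> x2) + 2 * lam * (x2 \<bullet> x3) + x3 \<bullet> (Sd *v x3) + lam * (x4 \<bullet> x4)
    + (\<Sum>j<N. rho * (x5 j \<bullet> x5 j)) + 2 * kw * (\<Sum>j<N. x5 j \<bullet> (S j *v x6 j))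
    + (\<Sum>j<N. x6 j \<bullet> (S j *v x6 j)) + rho * (x7 \<bullet> x7)"
    apply (subst sum.union_disjoint, (auto)[3])+
    apply (simp add: lmi_sum_image sum.distrib zero blk b16 b56 b66 b55)
    done
  finally show ?thesis by (simp add: F_def)
qed

section \<open>Solving the inequality by a sum of squares\<close>

lemma pos_def_imp_psd: "pos_def X \<Longrightarrow> psd X"
  unfolding pos_def_def psd_def by (metis inner_zero_left order.refl less_imp_le)

lemma psd_inner_commute:
  assumes "psd X"
  shows "x \<bullet> (X *v y) = y \<bullet> (X *v x)"
proof -
  have "x \<bullet> (X *v y) = (transpose X *v x) \<bullet> y"
    by (simp add: dot_lmul_matrix)
  also have "\<dots> = y \<bullet> (X *v x)"
    using assms by (simp add: psd_def inner_commute)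
  finally show ?thesis .
qed

lemma psd_form_add:
  assumes "psd X"
  shows "(x + y) \<bullet> (X *v (x + y)) = x \<bullet> (X *v x) + 2 * (x \<bullet> (X *v y)) + y \<bullet> (X *v y)"
  using psd_inner_commute[OF assms, of x y]
  by (simp add: matrix_vector_right_distrib inner_add_left inner_add_right)

text \<open>
  Young's inequality for a semidefinite form, from \<open>t *\<^sub>R x - y\<close>. The free parameter \<open>t\<close> decides which
  of the two terms gets a coefficient close to one.
\<close>

lemma psd_form_young:
  assumes "psd X" "t > 0"
  shows "(x + y) \<bullet> (X *v (x + y)) \<le> (1 + t) * (x \<bullet> (X *v x)) + (1 + 1 / t) * (y \<bullet> (X *v y))"
proof -
  have "0 \<le> (t *\<^sub>R x + (- 1) *\<^sub>R y) \<bullet> (X *v (t *\<^sub>R x + (- 1) *\<^sub>R y))"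
    using assms(1) unfolding psd_def by blast
  also have "\<dots> = t * (t * (x \<bullet> (X *v x))) - 2 * (t * (x \<bullet> (X *v y))) + y \<bullet> (X *v y)"
    unfolding psd_form_add[OF assms(1)] matrix_vector_mult_scaleR by simp
  finally have "2 * (x \<bullet> (X *v y)) \<le> t * (x \<bullet> (X *v x)) + (1 / t) * (y \<bullet> (X *v y))"
    using assms(2) by (simp add: field_simps power2_eq_square)
  then show ?thesis
    unfolding psd_form_add[OF assms(1)] by (simp add: algebra_simps)
qed

lemma inner_matrix_le_of_bound:
  assumes "norm (X *v x) \<le> k * norm x"
  shows "x \<bullet> (X *v x) \<le> k * (x \<bullet> x)"
proof -
  have "x \<bullet> (X *v x) \<le> norm x * norm (X *v x)"
    by (rule norm_cauchy_schwarz)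
  also have "\<dots> \<le> norm x * (k * norm x)"
    by (intro mult_left_mono assms) simp
  finally show ?thesis
    by (simp add: power2_norm_eq_inner[symmetric] power2_eq_square ac_simps)
qed

lemma matrix_sum_mult: "(\<Sum>j\<in>I. X j) *v x = (\<Sum>j\<in>I. X j *v x)"
  by (induction I rule: infinite_finite_induct) (simp_all add: matrix_vector_mult_add_rdistrib)

lemma mat_mult_vec: "mat k *v x = k *\<^sub>R (x :: real^'n)"
  by (simp add: vec_eq_iff matrix_vector_mult_def mat_def if_distrib[of "\<lambda>x. x * _"] cong: if_cong)

lemma transpose_mat_add: "transpose (X + Y) = transpose X + transpose (Y :: real^'m^'n)"
  by (simp add: transpose_def vec_eq_iff)

lemma psd_weighted_sum:
  assumes "\<And>j. j \<in> I \<Longrightarrow> psd (S j)" "\<And>j. j \<in> I \<Longrightarrow> 0 \<le> w j"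
  shows "psd (\<Sum>j\<in>I. w j *\<^sub>R S j)"
proof -
  have "transpose (\<Sum>j\<in>I. w j *\<^sub>R S j) = (\<Sum>j\<in>I. w j *\<^sub>R transpose (S j))"
    by (simp add: transpose_def vec_eq_iff)
  then show ?thesis
    using assms by (simp add: psd_def matrix_sum_mult inner_sum_right scaleR_matrix_vector_assoc[symmetric] sum_nonneg)
qed

text \<open>
  The bound on the matrices is asked only where the weight is nonzero, so that cells of measure zero
  do not count.
\<close>

lemma norm_weighted_sum_le:
  fixes S :: "'i \<Rightarrow> real^'n^'m"
  assumes "\<And>j. j \<in> I \<Longrightarrow> 0 \<le> w j" "(\<Sum>j\<in>I. w j) \<le> 1" "0 \<le> s"
    "\<And>j. j \<in> I \<Longrightarrow> w j \<noteq> 0 \<Longrightarrow> norm (S j *v x) \<le> s * norm x"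
  shows "norm ((\<Sum>j\<in>I. w j *\<^sub>R S j) *v x) \<le> s * norm x"
proof -
  have "norm ((\<Sum>j\<in>I. w j *\<^sub>R S j) *v x) \<le> (\<Sum>j\<in>I. w j * norm (S j *v x))"
    unfolding matrix_sum_mult scaleR_matrix_vector_assoc[symmetric]
    by (rule sum_norm_le) (use assms(1) in \<open>simp add: scaleR_matrix_vector_assoc[symmetric]\<close>)
  also have "\<dots> \<le> (\<Sum>j\<in>I. w j * (s * norm x))"
    using assms(1,4) by (intro sum_mono) (metis mult_left_mono mult_zero_left order.refl)
  also have "\<dots> = (\<Sum>j\<in>I. w j) * (s * norm x)"
    by (simp add: sum_distrib_right)
  also have "\<dots> \<le> 1 * (s * norm x)"
    using assms by (intro mult_right_mono) auto
  finally show ?thesis by simp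
qed

lemma hstack_mult_vec:
  "hstack X Y *v x = X *v (\<chi> a. x $ Inl a) + Y *v (\<chi> b. x $ Inr b)"
  unfolding UNIV_Plus_UNIV[symmetric] hstack_def matrix_vector_mult_def
  by (simp add: vec_eq_iff sum.Plus UNIV_Plus_UNIV[symmetric] del: UNIV_Plus_UNIV)

lemma inner_sum_type:
  fixes x y :: "real^('n::finite + 'r::finite)"
  shows "x \<bullet> y = (\<chi> a. x $ Inl a) \<bullet> (\<chi> a. y $ Inl a) + (\<chi> b. x $ Inr b) \<bullet> (\<chi> b. y $ Inr b)"
  by (simp add: inner_vec_def sum.Plus UNIV_Plus_UNIV[symmetric] del: UNIV_Plus_UNIV)

text \<open>
  The form of Young's inequality that leaves half of \<open>lam * q\<^sup>2\<close> available.
\<close>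

lemma cross_term_bound:
  fixes x y :: "'a::real_inner"
  assumes "lam > 0" "norm x \<le> p" "norm y \<le> q" 
  shows "- (2 * k\<^sup>2 * p\<^sup>2 / lam) - lam / 2 * q\<^sup>2 \<le> 2 * k * (x \<bullet> y)"
proof -
  have "0 \<le> lam / 2 * norm (y + (2 * k / lam) *\<^sub>R x) ^ 2" using assms by simp
  also have "\<dots> = lam / 2 * (norm y)\<^sup>2 + 2 * k * (x \<bullet> y) + 2 * k\<^sup>2 * (norm x)\<^sup>2 / lam"
    unfolding power2_norm_eq_inner using assms(1)
    by (simp add: inner_add_left inner_add_right inner_commute field_simps power2_eq_square)
  also have "\<dots> \<le> lam / 2 * q\<^sup>2 + 2 * k * (x \<bullet> y) + 2 * k\<^sup>2 * p\<^sup>2 / lam"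
    using assms by (intro add_mono mult_left_mono divide_right_mono power_mono order.refl) auto
  finally show ?thesis by linarith
qed

lemma pos_defD: "pos_def X \<Longrightarrow> x \<bullet> (X *v x) \<le> 0 \<Longrightarrow> x = 0"
  unfolding pos_def_def by (meson not_le)

lemma symmetric_entry:
  assumes "transpose X = X"
  shows "X $ a $ b = X $ b $ a"
proof -
  have "X $ a $ b = transpose X $ b $ a"
    by (simp add: transpose_def)
  then show ?thesis
    by (simp only: assms)
qed

text \<open>
  The matrix inequality holds for \<open>U = W + mat \<beta>\<close> and \<open>U ** L\<close>, because its form is a sum of squares.
  Assumption \<open>c1\<close> keeps the coefficient of \<open>x3 \<bullet> x3\<close> positive, \<open>c2\<close> that of \<open>x1 \<bullet> x1\<close> and \<open>c3\<close> those of
  the \<open>x5 j \<bullet> x5 j\<close>. The usual choice would be to make \<open>U\<close> equal to the matrix that appears when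
  the other variables are eliminated; adding \<open>\<beta>\<close> to \<open>W\<close> instead dominates that matrix and avoids
  inverses.
\<close>

lemma lmi_pos_def:
  fixes S :: "nat \<Rightarrow> real^'n^'n" and L :: "real^'r^'n" and w :: "nat \<Rightarrow> 'x \<Rightarrow> real"
    and c :: 'x and N :: nat and YA :: "real^'n^'n" and YC :: "real^'n^'r" and \<beta> :: real
  defines "W \<equiv> \<Sum>j<N. w j c *\<^sub>R S j"
  defines "U \<equiv> W + mat \<beta>" and "G \<equiv> YA + L ** YC"
  assumes S: "\<And>j. j < N \<Longrightarrow> pos_def (S j)" and Sd: "pos_def Sd"
    and w: "\<And>j. j < N \<Longrightarrow> 0 \<le> w j c" "(\<Sum>j<N. w j c) = 1"
    and S_bound: "\<And>j x. j < N \<Longrightarrow> norm (S j *v x) \<le> s * norm x"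
    and G_bound: "\<And>x. norm (G *v x) \<le> \<gamma> * norm x"
    and L_bound: "\<And>x. norm (L *v x) \<le> l * norm x"
    and decay: "\<And>x. e * (x \<bullet> x) \<le> x \<bullet> (Sd *v x) - (G *v x) \<bullet> (W *v (G *v x))"
    and pos: "0 \<le> s" "0 \<le> l" "0 < \<beta>" "0 < lam" "0 < rho" "0 < t"
    and c1: "lam + \<beta> * \<gamma>\<^sup>2 < e"
    and c2: "t * s + rho + 2 * \<kappa>\<^sup>2 * ((s + \<beta>) * (1 + l))\<^sup>2 / lam < \<beta>"
    and c3: "(1 + 1 / t) * \<kappa>\<^sup>2 * s < rho"
  shows "ix_pos_def (lmi_indices N)
    (lmi_matrix N YA YC (sqrt_weight_row w c) \<kappa> \<kappa> S Sd U (U ** L) lam rho)"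
proof -
  have psdS: "psd (S j)" if "j < N" for j using S[OF that] by (rule pos_def_imp_psd)
  have psdW: "psd W" unfolding W_def using psdS w by (intro psd_weighted_sum) auto
  have Umult: "U *v x = W *v x + \<beta> *\<^sub>R x" for x
    by (simp add: U_def matrix_vector_mult_add_rdistrib mat_mult_vec)
  have tU: "transpose U = U"
    using psdW by (simp add: U_def transpose_mat_add psd_def)
  have psdU: "psd U"
    using psdW pos tU by (simp add: psd_def Umult inner_add_right)
  have W_bound: "norm (W *v x) \<le> s * norm x" for x
    unfolding W_def using w S_bound pos by (intro norm_weighted_sum_le) auto
  have U_bound: "norm (U *v x) \<le> (s + \<beta>) * norm x" for x
    using norm_triangle_ineq[of "W *v x" "\<beta> *\<^sub>R x"] W_bound[of x] pos by (simp add: Umult algebra_simps)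
  have pos_form: "0 < (\<Sum>i\<in>lmi_indices N. \<Sum>j\<in>lmi_indices N.
      v i * lmi_matrix N YA YC (sqrt_weight_row w c) \<kappa> \<kappa> S Sd U (U ** L) lam rho i j * v j)"
    if v: "\<exists>i\<in>lmi_indices N. v i \<noteq> 0" for v
  proof (rule ccontr)
    define x1 x2 x3 x7 where "x1 = (\<chi> a. v (B1 a))" and "x2 = (\<chi> a. v (B2 a))"
      and "x3 = (\<chi> a. v (B3 a))" and "x7 = (\<chi> a. v (B7 a))"
    define x4 where "x4 = (\<chi> k. v (B4 k))"
    define x5 x6 where "x5 j = (\<chi> a. v (B5 (j, a)))" and "x6 j = (\<chi> a. v (B6 (j, a)))" for j
    define xa xb where "xa = (\<chi> a. x4 $ Inl a)" and "xb = (\<chi> b. x4 $ Inr b)"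
    \<comment> \<open>\<open>- z j\<close> minimises the form in \<open>x6 j\<close> when the other variables are fixed.\<close>
    define z where "z j = sqrt (w j c) *\<^sub>R x1 + \<kappa> *\<^sub>R x5 j" for j
    define k where "k = 2 * \<kappa>\<^sup>2 * ((s + \<beta>) * (1 + l))\<^sup>2 / lam"
    define r where "r = (1 + 1 / t) * \<kappa>\<^sup>2 * s"
    assume "\<not> ?thesis"
    then have Q: "x1 \<bullet> ((U + transpose U) *v x1) + 2 * (x1 \<bullet> ((U ** YA + (U ** L) ** YC) *v x3))
      + 2 * \<kappa> * (x1 \<bullet> (hstack U (U ** L) *v x4))
      + 2 * (\<Sum>j<N. sqrt (w j c) * (x1 \<bullet> (S j *v x6 j))) + 2 * rho * (x1 \<bullet> x7)
    + lam * (x2 \<bullet> x2) + 2 * lam * (x2 \<bullet> x3) + x3 \<bullet> (Sd *v x3) + lam * (x4 \<bullet> x4)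
    + (\<Sum>j<N. rho * (x5 j \<bullet> x5 j)) + 2 * \<kappa> * (\<Sum>j<N. x5 j \<bullet> (S j *v x6 j))
    + (\<Sum>j<N. x6 j \<bullet> (S j *v x6 j)) + rho * (x7 \<bullet> x7) \<le> 0"
      unfolding lmi_form not_less x1_def x2_def x3_def x4_def x5_def x6_def x7_def .
    have F1: "x1 \<bullet> ((U + transpose U) *v x1) = 2 * (x1 \<bullet> (U *v x1))"
      unfolding tU matrix_vector_mult_add_rdistrib inner_add_right by simp
    have F1': "x1 \<bullet> (U *v x1) = x1 \<bullet> (W *v x1) + \<beta> * (x1 \<bullet> x1)"
      by (simp add: Umult inner_add_right)
    have "U ** YA + (U ** L) ** YC = U ** G"
      by (simp add: G_def matrix_add_ldistrib matrix_mul_assoc)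
    then have F2: "x1 \<bullet> ((U ** YA + (U ** L) ** YC) *v x3) = x1 \<bullet> (U *v (G *v x3))"
      by (simp add: matrix_vector_mul_assoc)
    have "0 \<le> (x1 + G *v x3) \<bullet> (U *v (x1 + G *v x3))"
      using psdU by (simp add: psd_def)
    then have F3: "0 \<le> x1 \<bullet> (U *v x1) + 2 * (x1 \<bullet> (U *v (G *v x3)))
        + (G *v x3) \<bullet> (W *v (G *v x3)) + \<beta> * ((G *v x3) \<bullet> (G *v x3))"
      unfolding psd_form_add[OF psdU] Umult[of "G *v x3"] by (simp add: inner_add_right)
    have F3': "\<beta> * ((G *v x3) \<bullet> (G *v x3)) \<le> (\<beta> * \<gamma>\<^sup>2) * (x3 \<bullet> x3)"
    proof -
      have "(norm (G *v x3))\<^sup>2 \<le> (\<gamma> * norm x3)\<^sup>2"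
        by (intro power_mono G_bound) simp
      then show ?thesis using pos by (simp add: power2_norm_eq_inner power_mult_distrib mult.assoc)
    qed
    have n4: "x4 \<bullet> x4 = xa \<bullet> xa + xb \<bullet> xb"
      by (simp add: inner_sum_type[of x4] xa_def xb_def)
    have F4: "- (k * (x1 \<bullet> x1)) - lam * (x4 \<bullet> x4) / 2 \<le> 2 * \<kappa> * (x1 \<bullet> (hstack U (U ** L) *v x4))"
    proof -
      \<comment> \<open>Scaling by \<open>1 + l\<close> normalises the second factor to norm at most \<open>norm x4\<close>.\<close>
      have e: "x1 \<bullet> (hstack U (U ** L) *v x4) = ((1 + l) *\<^sub>R (U *v x1)) \<bullet> ((1 / (1 + l)) *\<^sub>R (xa + L *v xb))"
        using pos psd_inner_commute[OF psdU, of x1 "xa + L *v xb"]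
        by (simp add: hstack_mult_vec xa_def[symmetric] xb_def[symmetric] matrix_vector_mul_assoc[symmetric]
            matrix_vector_right_distrib[symmetric] inner_commute)
      have na: "norm xa \<le> norm x4" "norm xb \<le> norm x4"
        using n4 by (simp_all add: norm_eq_sqrt_inner)
      have "norm (xa + L *v xb) \<le> norm xa + l * norm xb"
        using norm_triangle_ineq[of xa "L *v xb"] L_bound[of xb] by linarith
      also have "\<dots> \<le> norm x4 + l * norm x4"
        using na pos by (intro add_mono mult_left_mono)
      finally have q: "norm ((1 / (1 + l)) *\<^sub>R (xa + L *v xb)) \<le> norm x4"
        using pos unfolding norm_scaleR by (simp add: field_simps)
      have p: "norm ((1 + l) *\<^sub>R (U *v x1)) \<le> (s + \<beta>) * (1 + l) * norm x1"
        using mult_left_mono[OF U_bound[of x1], of "1 + l"] pos by (simp add: ac_simps)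
      show ?thesis
        using cross_term_bound[OF pos(4) p q, of \<kappa>] unfolding e k_def
        by (simp add: power_mult_distrib power2_norm_eq_inner ac_simps)
    qed
    have T6: "(\<Sum>j<N. (x6 j + z j) \<bullet> (S j *v (x6 j + z j))) - (1 + t) * (x1 \<bullet> (W *v x1)) - r * (\<Sum>j<N. x5 j \<bullet> x5 j)
      \<le> 2 * (\<Sum>j<N. sqrt (w j c) * (x1 \<bullet> (S j *v x6 j))) + 2 * \<kappa> * (\<Sum>j<N. x5 j \<bullet> (S j *v x6 j))
        + (\<Sum>j<N. x6 j \<bullet> (S j *v x6 j))"
    proof -
      have "(x6 j + z j) \<bullet> (S j *v (x6 j + z j)) - (1 + t) * (w j c * (x1 \<bullet> (S j *v x1))) - r * (x5 j \<bullet> x5 j)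
        \<le> 2 * (sqrt (w j c) * (x1 \<bullet> (S j *v x6 j))) + 2 * \<kappa> * (x5 j \<bullet> (S j *v x6 j)) + x6 j \<bullet> (S j *v x6 j)"
        if j: "j \<in> {..<N}" for j
      proof -
        have p: "psd (S j)" and w0: "0 \<le> w j c" using j psdS w by auto
        have "z j \<bullet> (S j *v z j) \<le> (1 + t) * (w j c * (x1 \<bullet> (S j *v x1))) + (1 + 1 / t) * (\<kappa>\<^sup>2 * (x5 j \<bullet> (S j *v x5 j)))"
          using psd_form_young[OF p pos(6), of "sqrt (w j c) *\<^sub>R x1" "\<kappa> *\<^sub>R x5 j"] w0
          by (simp add: z_def matrix_vector_mult_scaleR power2_eq_square mult.assoc[symmetric])
        also have "(1 + 1 / t) * (\<kappa>\<^sup>2 * (x5 j \<bullet> (S j *v x5 j))) \<le> (1 + 1 / t) * (\<kappa>\<^sup>2 * (s * (x5 j \<bullet> x5 j)))"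
          using pos S_bound j by (intro mult_left_mono inner_matrix_le_of_bound) auto
        finally have "z j \<bullet> (S j *v z j) \<le> (1 + t) * (w j c * (x1 \<bullet> (S j *v x1))) + r * (x5 j \<bullet> x5 j)"
          by (simp add: r_def mult.assoc)
        moreover have "x6 j \<bullet> (S j *v z j) = sqrt (w j c) * (x1 \<bullet> (S j *v x6 j)) + \<kappa> * (x5 j \<bullet> (S j *v x6 j))"
          by (subst psd_inner_commute[OF p]) (simp add: z_def inner_add_left)
        ultimately show ?thesis
          by (simp add: psd_form_add[OF p])
      qed
      note sum_mono[of "{..<N}", OF this]
      moreover have "x1 \<bullet> (W *v x1) = (\<Sum>j<N. w j c * (x1 \<bullet> (S j *v x1)))"
        by (simp add: W_def matrix_sum_mult inner_sum_right scaleR_matrix_vector_assoc[symmetric])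
      ultimately show ?thesis
        by (simp add: sum.distrib sum_subtractf sum_distrib_left)
    qed
    have T1: "t * (x1 \<bullet> (W *v x1)) \<le> (t * s) * (x1 \<bullet> x1)"
      using inner_matrix_le_of_bound[OF W_bound, of x1] pos by (simp add: mult.assoc)
    have T7: "rho * ((x7 + x1) \<bullet> (x7 + x1)) = rho * (x7 \<bullet> x7) + 2 * rho * (x1 \<bullet> x7) + rho * (x1 \<bullet> x1)"
      by (simp add: inner_add_left inner_add_right inner_commute algebra_simps)
    have T2: "lam * ((x2 + x3) \<bullet> (x2 + x3)) = lam * (x2 \<bullet> x2) + 2 * lam * (x2 \<bullet> x3) + lam * (x3 \<bullet> x3)"
      by (simp add: inner_add_left inner_add_right inner_commute algebra_simps)
    note d3 = decay[of x3]
    have "(\<Sum>j<N. (x6 j + z j) \<bullet> (S j *v (x6 j + z j))) + rho * ((x7 + x1) \<bullet> (x7 + x1))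
        + lam * ((x2 + x3) \<bullet> (x2 + x3)) + lam * (x4 \<bullet> x4) / 2 + (\<beta> - t * s - rho - k) * (x1 \<bullet> x1)
        + (e - lam - \<beta> * \<gamma>\<^sup>2) * (x3 \<bullet> x3) + (rho - r) * (\<Sum>j<N. x5 j \<bullet> x5 j) \<le> 0"
      using Q F1 F1' F2 F3 F3' F4 T6 T1 T7 T2 d3
      unfolding sum_distrib_left[symmetric] left_diff_distrib distrib_right mult.assoc mult_1 by linarith
    moreover have "0 \<le> (\<Sum>j<N. (x6 j + z j) \<bullet> (S j *v (x6 j + z j)))"
      using psdS by (intro sum_nonneg) (auto simp: psd_def)
    moreover have "0 \<le> (\<Sum>j<N. x5 j \<bullet> x5 j)" by (intro sum_nonneg) simp
    moreover have cc: "0 < \<beta> - t * s - rho - k" "0 < e - lam - \<beta> * \<gamma>\<^sup>2" "0 < rho - r"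
      using c1 c2 c3 by (simp_all add: k_def r_def)
    moreover have "0 \<le> rho * ((x7 + x1) \<bullet> (x7 + x1))" "0 \<le> lam * ((x2 + x3) \<bullet> (x2 + x3))"
       "0 \<le> lam * (x4 \<bullet> x4) / 2" "0 \<le> (\<beta> - t * s - rho - k) * (x1 \<bullet> x1)"
       "0 \<le> (e - lam - \<beta> * \<gamma>\<^sup>2) * (x3 \<bullet> x3)" "0 \<le> (rho - r) * (\<Sum>j<N. x5 j \<bullet> x5 j)"
      using pos cc \<open>0 \<le> (\<Sum>j<N. x5 j \<bullet> x5 j)\<close> by (auto intro!: mult_nonneg_nonneg)
    ultimately have
      z: "(\<Sum>j<N. (x6 j + z j) \<bullet> (S j *v (x6 j + z j))) = 0"
       "rho * ((x7 + x1) \<bullet> (x7 + x1)) = 0" "lam * ((x2 + x3) \<bullet> (x2 + x3)) = 0"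
       "lam * (x4 \<bullet> x4) / 2 = 0" "(\<beta> - t * s - rho - k) * (x1 \<bullet> x1) = 0"
       "(e - lam - \<beta> * \<gamma>\<^sup>2) * (x3 \<bullet> x3) = 0" "(rho - r) * (\<Sum>j<N. x5 j \<bullet> x5 j) = 0"
      by linarith+
    have x1: "x1 = 0" and x3: "x3 = 0" and s5: "(\<Sum>j<N. x5 j \<bullet> x5 j) = 0" and x4: "x4 = 0"
      using z cc pos by auto
    have x2: "x2 = 0" and x7: "x7 = 0" using z pos x1 x3 by auto
    have x5: "x5 j = 0" if "j < N" for j
      using s5 that by (subst (asm) sum_nonneg_eq_0_iff) auto
    have x6: "x6 j = 0" if j: "j < N" for j
    proof -
      have "\<forall>j\<in>{..<N}. (x6 j + z j) \<bullet> (S j *v (x6 j + z j)) = 0"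
        using z(1) psdS by (subst (asm) sum_nonneg_eq_0_iff) (auto simp: psd_def)
      then have "x6 j + z j = 0" using j pos_defD[OF S[OF j]] by auto
      then show ?thesis using x1 x5[OF j] by (simp add: z_def)
    qed
    have "v i = 0" if "i \<in> lmi_indices N" for i
      using that x1 x2 x3 x4 x5 x6 x7
      unfolding x1_def x2_def x3_def x4_def x5_def x6_def x7_def
      by (auto simp: lmi_indices_def stacked_def vec_eq_iff)
    then show False using v by blast
  qed
  have symS: "S j $ a $ b = S j $ b $ a" if "j < N" for j a b
    using S[OF that] by (intro symmetric_entry) (simp add: pos_def_def)
  have symSd: "Sd $ a $ b = Sd $ b $ a" for a b
    using Sd by (intro symmetric_entry) (simp add: pos_def_def)
  have symU: "U $ a $ b = U $ b $ a" for a b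
    by (rule symmetric_entry[OF tU])
  have symm: "lmi_matrix N YA YC (sqrt_weight_row w c) \<kappa> \<kappa> S Sd U (U ** L) lam rho i j =
     lmi_matrix N YA YC (sqrt_weight_row w c) \<kappa> \<kappa> S Sd U (U ** L) lam rho j i"
    if "i \<in> lmi_indices N" "j \<in> lmi_indices N" for i j
  proof (cases "block_no i = block_no j")
    case True
    then show ?thesis
      using that
      by (auto simp: lmi_indices_def lmi_matrix_def lmi_upper_def tU symU symSd symS block_diag_def stacked_def
          mat_component)
  next
    case False
    then show ?thesis by (auto simp: lmi_matrix_def)
  qed
  show ?thesis unfolding ix_pos_def_def using pos_form symm by blast
qed

section \<open>Norms of matrices and matrix functions\<close>

lemma norm_le_opnorm: "norm (X *v x) \<le> opnorm X * norm x"
  unfolding opnorm_def by (rule onorm[OF matrix_vector_mul_bounded_linear])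

lemma norm_mult_vec_le:
  assumes "opnorm X \<le> k"
  shows "norm (X *v x) \<le> k * norm x"
  using norm_le_opnorm[of X x] mult_right_mono[OF assms norm_ge_zero[of x]] by linarith

lemma AE_opnorm_less:
  assumes "sup_norm \<mu> P < ereal k"
  shows "AE x in \<mu>. opnorm (P x) < k"
  using esssup_AE[of "\<lambda>x. ereal (opnorm (P x))" \<mu>]
proof eventually_elim
  case (elim x)
  then have "ereal (opnorm (P x)) < ereal k"
    using assms unfolding sup_norm_def by (rule le_less_trans)
  then show ?case by simp
qed

lemma form_diff_le:
  assumes "opnorm (X - Y) \<le> k"
  shows "y \<bullet> (X *v y) \<le> y \<bullet> (Y *v y) + k * (y \<bullet> (y::real^'n))"
proof -
  have "y \<bullet> ((X - Y) *v y) \<le> k * (y \<bullet> y)"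
    by (rule inner_matrix_le_of_bound[OF norm_mult_vec_le[OF assms]])
  then show ?thesis by (simp add: matrix_vector_mult_diff_rdistrib inner_diff_right)
qed

lemma opnorm_minus_commute: "opnorm (X - Y) = opnorm (Y - X)"
proof -
  have "(\<lambda>v. (X - Y) *v v) = (\<lambda>v. - ((Y - X) *v v))"
    by (simp add: matrix_vector_mult_diff_rdistrib)
  then show ?thesis unfolding opnorm_def by (simp add: onorm_neg)
qed

lemma H_sup_bound:
  assumes "P \<in> H_sup \<mu>"
  obtains k where "0 \<le> k" "AE x in \<mu>. opnorm (P x) \<le> k"
proof -
  obtain k where k: "sup_norm \<mu> P < ereal k"
    using assms less_PInf_Ex_of_nat[of "sup_norm \<mu> P"] by (auto simp: H_sup_def)
  have "AE x in \<mu>. opnorm (P x) \<le> max 0 k"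
    using AE_opnorm_less[OF k] by eventually_elim simp
  then show thesis by (rule that[rotated]) simp
qed

lemma vstack_mult_vec:
  fixes X :: "real^'m^'n" and Y :: "real^'m^'r"
  shows "(\<chi> a. (vstack X Y *v x) $ Inl a) = X *v x" "(\<chi> b. (vstack X Y *v x) $ Inr b) = Y *v x"
  by (simp_all add: vec_eq_iff matrix_vector_mult_def vstack_def)

lemma vstack_diff: "vstack X Y - vstack X' Y' = vstack (X - X') (Y - Y')"
  by (auto simp: vec_eq_iff vstack_def split: sum.split)

text \<open>
  The blocks of a stacked product are orthogonal, so neither is longer than the product itself.
\<close>

lemma norm_vstack_parts:
  assumes "opnorm (vstack X Y) \<le> k"
  shows "norm (X *v x) \<le> k * norm x" "norm (Y *v x) \<le> k * norm x"
proof -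
  have "norm (X *v x) \<le> norm (vstack X Y *v x)" "norm (Y *v x) \<le> norm (vstack X Y *v x)"
    using inner_sum_type[of "vstack X Y *v x" "vstack X Y *v x"]
    unfolding vstack_mult_vec by (simp_all add: norm_eq_sqrt_inner)
  then show "norm (X *v x) \<le> k * norm x" "norm (Y *v x) \<le> k * norm x"
    using norm_mult_vec_le[OF assms, of x] by linarith+
qed

text \<open>
  The row of blocks \<open>d j\<close> times the identity acts on each coordinate \<open>a\<close> separately as the linear
  form with coefficients \<open>d j\<close>, so Cauchy and Schwarz applies coordinatewise.
\<close>

lemma sqrt_weight_row_opnorm:
  "ix_opnorm (UNIV :: 'n::finite set) (stacked N)
     (\<lambda>a b. sqrt_weight_row w x a b - sqrt_weight_row w y a b)
   \<le> L2_set (\<lambda>j. sqrt (w j x) - sqrt (w j y)) {..<N}"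
  unfolding ix_opnorm_def
proof (rule cSUP_least)
  have "L2_set (\<lambda>_. 0) (stacked N :: (nat \<times> 'n) set) \<le> 1"
    by (simp add: L2_set_def)
  then show "{v. L2_set v (stacked N :: (nat \<times> 'n) set) \<le> 1} \<noteq> {}"
    by blast
next
  define d where "d j = sqrt (w j x) - sqrt (w j y)" for j
  fix v :: "nat \<times> 'n \<Rightarrow> real"
  assume "v \<in> {v. L2_set v (stacked N) \<le> 1}"
  then have v: "L2_set v (stacked N) \<le> 1" by simp
  have row: "(\<Sum>p\<in>stacked N. (sqrt_weight_row w x a p - sqrt_weight_row w y a p) * v p) = (\<Sum>j<N. d j * v (j, a))" for a
    unfolding sum_stacked
  proof (rule sum.cong[OF refl])
    fix j
    have "(\<Sum>b\<in>UNIV. (sqrt_weight_row w x a (j, b) - sqrt_weight_row w y a (j, b)) * v (j, b))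
      = (\<Sum>b\<in>UNIV. if a = b then d j * v (j, b) else 0)"
      by (intro sum.cong) (auto simp: sqrt_weight_row_def d_def)
    then show "(\<Sum>b\<in>UNIV. (sqrt_weight_row w x a (j, b) - sqrt_weight_row w y a (j, b)) * v (j, b)) = d j * v (j, a)"
      by simp
  qed
  have "(\<Sum>a\<in>UNIV. (\<Sum>j<N. d j * v (j, a))\<^sup>2) \<le> (\<Sum>a\<in>UNIV. (\<Sum>j<N. (d j)\<^sup>2) * (\<Sum>j<N. (v (j, a))\<^sup>2))"
    by (intro sum_mono Cauchy_Schwarz_ineq_sum)
  also have "\<dots> = (\<Sum>j<N. (d j)\<^sup>2) * (\<Sum>p\<in>stacked N. (v p)\<^sup>2)"
    unfolding sum_stacked sum_distrib_left[symmetric] by (subst sum.swap) simp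
  finally have "L2_set (\<lambda>a. \<Sum>j<N. d j * v (j, a)) UNIV \<le> L2_set d {..<N} * L2_set v (stacked N)"
    unfolding L2_set_def real_sqrt_mult[symmetric] by (rule real_sqrt_le_mono)
  also have "\<dots> \<le> L2_set d {..<N} * 1"
    by (intro mult_left_mono v) simp
  finally show "L2_set (\<lambda>a. \<Sum>p\<in>stacked N. (sqrt_weight_row w x a p - sqrt_weight_row w y a p) * v p) UNIV
     \<le> L2_set (\<lambda>j. sqrt (w j x) - sqrt (w j y)) {..<N}"
    by (simp add: row d_def[symmetric])
qed

lemma continuous_matrix_bounded:
  fixes A :: "'a::topological_space \<Rightarrow> real^'m^'n"
  assumes "compact M" "continuous_on M A"
  obtains k where "0 \<le> k" "\<And>x v. x \<in> M \<Longrightarrow> norm (A x *v v) \<le> k * norm v"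
proof -
  obtain b where b: "0 < b" "\<And>x. x \<in> M \<Longrightarrow> norm (A x) \<le> b"
    using compact_imp_bounded[OF compact_continuous_image[OF assms(2,1)]]
    by (auto simp: bounded_pos)
  define k where "k = real CARD('n) * real CARD('m) * b"
  have "opnorm (A x) \<le> k" if "x \<in> M" for x
    unfolding opnorm_def k_def
  proof (rule onorm_le_matrix_component)
    fix i j
    show "\<bar>A x $ i $ j\<bar> \<le> b"
      using component_le_norm_cart[of "A x $ i" j] Finite_Cartesian_Product.norm_nth_le[of "A x" i] b(2)[OF that] by linarith
  qed
  then show thesis
    using b(1) by (intro that[of k] norm_mult_vec_le) (auto simp: k_def)
qed

lemma is_product_box_borel:
  assumes "is_product_box (B :: (real^'p) set)"
  shows "B \<in> sets borel"
proof -
  obtain J :: "'p \<Rightarrow> real set" where J: "\<And>k. is_interval (J k)" and B: "B = {x. \<forall>k. x $ k \<in> J k}"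
    using assms unfolding is_product_box_def by blast
  have "B = (\<Inter>k\<in>UNIV. (\<lambda>x. x $ k) -` J k \<inter> space borel)"
    by (auto simp: B)
  moreover have "(\<lambda>x::real^'p. x $ k) -` J k \<inter> space borel \<in> sets borel" for k
    using J[of k] by (intro measurable_sets[OF borel_measurable_continuous_onI])
      (auto intro!: continuous_intros real_interval_borel_measurable)
  ultimately show ?thesis
    by (simp only:) (rule sets.finite_INT, simp_all)
qed

section \<open>Weights and integrals on a box partition\<close>

locale cells =
  fixes M :: "(real^'p) set" and \<mu> g and N :: nat and B :: "nat \<Rightarrow> (real^'p) set"
  assumes sets_\<mu>: "sets \<mu> = sets (restrict_space borel M)"
    and density: "transition_density \<mu> g"
    and partition: "box_partition M N B"
begin

abbreviation w :: "nat \<Rightarrow> real^'p \<Rightarrow> real" where "w \<equiv> cell_weight \<mu> g B"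

lemma space_\<mu>: "space \<mu> = M"
  using sets_eq_imp_space_eq[OF sets_\<mu>] by (simp add: space_restrict_space)

lemma cell_subset: "i < N \<Longrightarrow> B i \<subseteq> M"
  using partition by (auto simp: box_partition_def)

lemma cell_sets [measurable]: "i < N \<Longrightarrow> B i \<in> sets \<mu>"
  using partition is_product_box_borel[of "B i"] cell_subset[of i]
  unfolding sets_\<mu> sets_restrict_space box_partition_def by (auto simp: image_iff)

lemma cell_exists: "x \<in> M \<Longrightarrow> \<exists>i<N. x \<in> B i"
  using partition by (auto simp: box_partition_def)

lemma cell_unique: "i < N \<Longrightarrow> j < N \<Longrightarrow> x \<in> B i \<Longrightarrow> x \<in> B j \<Longrightarrow> i = j"
  using partition by (auto simp: box_partition_def disjoint_family_on_def)

text \<open>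
  Everything follows from comparison with the transition kernel. Nonnegativity holds almost
  everywhere because the set where the density is negative would otherwise have negative
  probability.
\<close>

lemma density_at:
  assumes "x \<in> M"
  shows density_integrable: "integrable \<mu> (g x)"
    and density_integral: "(LINT l|\<mu>. g x l) = 1"
    and density_nonneg: "AE l in \<mu>. 0 \<le> g x l"
    and density_set_integral_nonneg: "D \<in> sets \<mu> \<Longrightarrow> 0 \<le> (LINT l:D|\<mu>. g x l)"
proof -
  obtain K where K: "K \<in> \<mu> \<rightarrow>\<^sub>M prob_algebra \<mu>" and
    "\<forall>x\<in>space \<mu>. integrable \<mu> (g x) \<and> (\<forall>B\<in>sets \<mu>. measure (K x) B = (LINT l:B|\<mu>. g x l))"
    using density unfolding transition_density_def by blast
  then have int: "integrable \<mu> (g x)" and meas: "\<And>D. D \<in> sets \<mu> \<Longrightarrow> measure (K x) D = (LINT l:D|\<mu>. g x l)"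
    using assms by (auto simp: space_\<mu>)
  show "integrable \<mu> (g x)" by (rule int)
  show nn: "0 \<le> (LINT l:D|\<mu>. g x l)" if "D \<in> sets \<mu>" for D
    using meas[OF that] measure_nonneg[of "K x" D] by simp
  have "K x \<in> space (prob_algebra \<mu>)"
    using measurable_space[OF K] assms by (simp add: space_\<mu>)
  then have "prob_space (K x)" "space (K x) = space \<mu>"
    by (auto simp: space_prob_algebra dest: sets_eq_imp_space_eq)
  then have "measure (K x) (space \<mu>) = 1"
    using prob_space.prob_space by metis
  then show "(LINT l|\<mu>. g x l) = 1"
    using meas[of "space \<mu>"] set_integral_space[OF int] by simp
  \<comment> \<open>The set of negative density: the integral over it is both nonnegative and nonpositive.\<close>
  define D where "D = {l \<in> space \<mu>. g x l < 0}"
  have D: "D \<in> sets \<mu>" using int unfolding D_def by measurable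
  have iD: "integrable \<mu> (\<lambda>l. - (indicator D l *\<^sub>R g x l))"
    using integrable_mult_indicator[OF D int] by simp
  have nnD: "AE l in \<mu>. 0 \<le> - (indicator D l *\<^sub>R g x l)"
    by (auto simp: D_def indicator_def)
  have "(LINT l|\<mu>. - (indicator D l *\<^sub>R g x l)) = 0"
    using nn[OF D] integral_nonneg_AE[OF nnD] by (simp add: set_lebesgue_integral_def)
  then have "AE l in \<mu>. - (indicator D l *\<^sub>R g x l) = 0"
    using integral_nonneg_eq_0_iff_AE[OF iD nnD] by simp
  then show "AE l in \<mu>. 0 \<le> g x l"
    using AE_space by eventually_elim (force simp: D_def indicator_def split: if_splits)
qed

lemma cell_weight_nonneg: "x \<in> M \<Longrightarrow> j < N \<Longrightarrow> 0 \<le> w j x"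
  unfolding cell_weight_def by (intro density_set_integral_nonneg cell_sets)

lemma cell_weight_null:
  assumes "AE l in \<mu>. l \<notin> B j"
  shows "w j x = 0"
proof -
  have "AE l in \<mu>. indicator (B j) l *\<^sub>R g x l = 0"
    using assms by eventually_elim simp
  then show ?thesis
    unfolding cell_weight_def set_lebesgue_integral_def by (rule integral_eq_zero_AE)
qed

lemma density_integral_piecewise:
  assumes x: "x \<in> M" and f: "\<And>j l. j < N \<Longrightarrow> l \<in> B j \<Longrightarrow> f l = fc j"
  shows "integrable \<mu> (\<lambda>l. g x l * f l)"
    and "(LINT l|\<mu>. g x l * f l) = (\<Sum>j<N. w j x * fc j)"
proof -
  have eq: "g x l * f l = (\<Sum>j<N. (indicator (B j) l *\<^sub>R g x l) * fc j)" if l: "l \<in> space \<mu>" for l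
  proof -
    obtain i where i: "i < N" "l \<in> B i" using cell_exists[of l] l by (auto simp: space_\<mu>)
    have "(\<Sum>j<N. (indicator (B j) l *\<^sub>R g x l) * fc j) = (\<Sum>j<N. if j = i then g x l * fc i else 0)"
      using i cell_unique by (intro sum.cong) (auto simp: indicator_def)
    then show ?thesis using i f by simp
  qed
  have int_cell: "integrable \<mu> (\<lambda>l. indicator (B j) l *\<^sub>R g x l)" if "j < N" for j
    by (rule integrable_mult_indicator[OF cell_sets[OF that] density_integrable[OF x]])
  then have int: "integrable \<mu> (\<lambda>l. (indicator (B j) l *\<^sub>R g x l) * fc j)" if "j < N" for j
    using that by (intro integrable_mult_left)
  have int_sum: "integrable \<mu> (\<lambda>l. \<Sum>j<N. (indicator (B j) l *\<^sub>R g x l) * fc j)"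
    by (rule Bochner_Integration.integrable_sum) (rule int, simp only: lessThan_iff)
  show "integrable \<mu> (\<lambda>l. g x l * f l)"
    by (rule iffD2[OF Bochner_Integration.integrable_cong[OF refl eq] int_sum])
  have "(LINT l|\<mu>. g x l * f l) = (LINT l|\<mu>. (\<Sum>j<N. (indicator (B j) l *\<^sub>R g x l) * fc j))"
    by (rule Bochner_Integration.integral_cong[OF refl eq])
  also have "\<dots> = (\<Sum>j<N. LINT l|\<mu>. (indicator (B j) l *\<^sub>R g x l) * fc j)"
    by (rule Bochner_Integration.integral_sum) (rule int, simp only: lessThan_iff)
  also have "\<dots> = (\<Sum>j<N. w j x * fc j)"
    by (simp add: cell_weight_def set_lebesgue_integral_def)
  finally show "(LINT l|\<mu>. g x l * f l) = (\<Sum>j<N. w j x * fc j)" .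
qed

lemma cell_weight_sum: "x \<in> M \<Longrightarrow> (\<Sum>j<N. w j x) = 1"
  using density_integral_piecewise(2)[of x "\<lambda>_. 1" "\<lambda>_. 1"] density_integral[of x] by simp

text \<open>
  The factorisation \<open>a - b = (sqrt a - sqrt b) * (sqrt a + sqrt b)\<close> and Cauchy and Schwarz; the vectors
  of square roots have norm one, whence the factor two. No number of cells enters, which is why the
  partition is compared through square roots of the weights.
\<close>

lemma cell_weight_L1_le:
  assumes x: "x \<in> M" and y: "y \<in> M"
  shows "(\<Sum>j<N. \<bar>w j x - w j y\<bar>) \<le> 2 * L2_set (\<lambda>j. sqrt (w j x) - sqrt (w j y)) {..<N}"
proof -
  have one: "L2_set (\<lambda>j. sqrt (w j u)) {..<N} = 1" if "u \<in> M" for u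
  proof -
    have "(\<Sum>j<N. (sqrt (w j u))\<^sup>2) = (\<Sum>j<N. w j u)"
      using that by (intro sum.cong) (auto simp: cell_weight_nonneg)
    then show ?thesis using cell_weight_sum[OF that] by (simp add: L2_set_def)
  qed
  have "(\<Sum>j<N. \<bar>w j x - w j y\<bar>) = (\<Sum>j<N. \<bar>sqrt (w j x) - sqrt (w j y)\<bar> * \<bar>sqrt (w j x) + sqrt (w j y)\<bar>)"
  proof (rule sum.cong[OF refl])
    fix j assume "j \<in> {..<N}"
    then have "w j x - w j y = (sqrt (w j x) - sqrt (w j y)) * (sqrt (w j x) + sqrt (w j y))"
      using x y by (simp add: algebra_simps cell_weight_nonneg)
    then show "\<bar>w j x - w j y\<bar> = \<bar>sqrt (w j x) - sqrt (w j y)\<bar> * \<bar>sqrt (w j x) + sqrt (w j y)\<bar>"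
      by (simp only: abs_mult)
  qed
  also have "\<dots> \<le> L2_set (\<lambda>j. sqrt (w j x) - sqrt (w j y)) {..<N} * L2_set (\<lambda>j. sqrt (w j x) + sqrt (w j y)) {..<N}"
    by (rule L2_set_mult_ineq)
  also have "\<dots> \<le> L2_set (\<lambda>j. sqrt (w j x) - sqrt (w j y)) {..<N} * 2"
    using L2_set_triangle_ineq[of "\<lambda>j. sqrt (w j x)" "\<lambda>j. sqrt (w j y)" "{..<N}"] one[OF x] one[OF y]
    by (intro mult_left_mono) auto
  finally show ?thesis by simp
qed

text \<open>
  Evaluating a quadratic form is linear in the matrix, so it commutes with the integral once the
  matrix integrand is known to be integrable.
\<close>

lemma density_integral_form:
  fixes S :: "real^'p \<Rightarrow> real^'n^'n"
  assumes x: "x \<in> M" and S: "S \<in> borel_measurable \<mu>" and b: "AE l in \<mu>. opnorm (S l) \<le> s"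
  shows "integrable \<mu> (\<lambda>l. g x l * (y \<bullet> (S l *v y)))"
    and "y \<bullet> ((LINT l|\<mu>. g x l *\<^sub>R S l) *v y) = (LINT l|\<mu>. g x l * (y \<bullet> (S l *v y)))"
proof -
  have gm [measurable]: "g x \<in> borel_measurable \<mu>"
    using density_integrable[OF x] by (rule borel_measurable_integrable)
  note S [measurable]
  define k where "k = real CARD('n) * (real CARD('n) * s)"
  have norm_S: "norm (S l) \<le> k" if "opnorm (S l) \<le> s" for l
  proof -
    have c: "\<bar>S l $ i $ j\<bar> \<le> s" for i j
      using matrix_component_le_onorm[of "S l" i j] that unfolding opnorm_def by linarith
    have "norm (S l $ i) \<le> real CARD('n) * s" for i
    proof -
      have "norm (S l $ i) \<le> (\<Sum>j\<in>UNIV. \<bar>S l $ i $ j\<bar>)" by (rule norm_le_l1_cart)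
      also have "\<dots> \<le> real CARD('n) * s" using sum_bounded_above[of UNIV "\<lambda>j. \<bar>S l $ i $ j\<bar>" s] c by simp
      finally show ?thesis .
    qed
    note r = this
    have "norm (S l) \<le> (\<Sum>i\<in>UNIV. norm (S l $ i))" unfolding norm_vec_def by (rule L2_set_le_sum) simp
    also have "\<dots> \<le> k" unfolding k_def using sum_bounded_above[of UNIV "\<lambda>i. norm (S l $ i)"] r by simp
    finally show ?thesis .
  qed
  have int: "integrable \<mu> (\<lambda>l. g x l *\<^sub>R S l)"
  proof (rule Bochner_Integration.integrable_bound)
    show "integrable \<mu> (\<lambda>l. k * g x l)" using density_integrable[OF x] by simp
    show "(\<lambda>l. g x l *\<^sub>R S l) \<in> borel_measurable \<mu>" by measurable
    show "AE l in \<mu>. norm (g x l *\<^sub>R S l) \<le> norm (k * g x l)"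
      using b
    proof eventually_elim
      case (elim l)
      then have "norm (S l) \<le> \<bar>k\<bar>" using norm_S[of l] by linarith
      then have "\<bar>g x l\<bar> * norm (S l) \<le> \<bar>g x l\<bar> * \<bar>k\<bar>" by (intro mult_left_mono) auto
      then show ?case by (simp add: abs_mult mult.commute)
    qed
  qed
  have lin: "bounded_linear (\<lambda>X :: real^'n^'n. y \<bullet> (X *v y))"
    unfolding linear_conv_bounded_linear[symmetric]
    by (rule linearI) (simp_all add: matrix_vector_mult_add_rdistrib inner_add_right scaleR_matrix_vector_assoc[symmetric])
  show "integrable \<mu> (\<lambda>l. g x l * (y \<bullet> (S l *v y)))"
    using integrable_bounded_linear[OF lin int] by (simp add: scaleR_matrix_vector_assoc[symmetric])
  show "y \<bullet> ((LINT l|\<mu>. g x l *\<^sub>R S l) *v y) = (LINT l|\<mu>. g x l * (y \<bullet> (S l *v y)))"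
    using integral_bounded_linear[OF lin int] by (simp add: scaleR_matrix_vector_assoc[symmetric])
qed

text \<open>
  As \<open>g x\<close> is nonnegative with total mass one, an error of at most \<open>\<eta>\<close> in the integrand is an error
  of at most \<open>\<eta>\<close> in the integral, and the piecewise constant integrand gives a finite sum.
\<close>

lemma density_integral_lower_bound:
  fixes S Sa :: "real^'p \<Rightarrow> real^'n^'n"
  assumes x: "x \<in> M" and S: "S \<in> borel_measurable \<mu>" "AE l in \<mu>. opnorm (S l) \<le> s"
    and close: "AE l in \<mu>. opnorm (S l - Sa l) < \<eta>"
    and Sa: "\<And>j l. j < N \<Longrightarrow> l \<in> B j \<Longrightarrow> Sa l = Sb j"
  shows "(\<Sum>j<N. w j x * (y \<bullet> (Sb j *v y))) - \<eta> * (y \<bullet> y) \<le> y \<bullet> ((LINT l|\<mu>. g x l *\<^sub>R S l) *v y)"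
proof -
  define f where "f l = y \<bullet> (Sa l *v y)" for l
  have f: "f l = y \<bullet> (Sb j *v y)" if "j < N" "l \<in> B j" for j l
    using Sa that by (simp add: f_def)
  note pw = density_integral_piecewise[OF x f]
  have "(\<Sum>j<N. w j x * (y \<bullet> (Sb j *v y))) - \<eta> * (y \<bullet> y) = (LINT l|\<mu>. g x l * f l) - (LINT l|\<mu>. g x l * (\<eta> * (y \<bullet> y)))"
    using pw(2) density_integral[OF x] by simp
  also have "\<dots> = (LINT l|\<mu>. g x l * f l - g x l * (\<eta> * (y \<bullet> y)))"
    using pw(1) density_integrable[OF x] by (subst Bochner_Integration.integral_diff) auto
  also have "\<dots> \<le> (LINT l|\<mu>. g x l * (y \<bullet> (S l *v y)))"
  proof (rule integral_mono_AE)
    show "integrable \<mu> (\<lambda>l. g x l * f l - g x l * (\<eta> * (y \<bullet> y)))"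
      using pw(1) density_integrable[OF x] by auto
    show "integrable \<mu> (\<lambda>l. g x l * (y \<bullet> (S l *v y)))"
      by (rule density_integral_form[OF x S])
    show "AE l in \<mu>. g x l * f l - g x l * (\<eta> * (y \<bullet> y)) \<le> g x l * (y \<bullet> (S l *v y))"
      using close density_nonneg[OF x]
    proof eventually_elim
      case (elim l)
      then have "f l - \<eta> * (y \<bullet> y) \<le> y \<bullet> (S l *v y)"
        using form_diff_le[of "Sa l" "S l" \<eta> y] by (simp add: f_def opnorm_minus_commute)
      then show ?case
        using elim mult_left_mono by (fastforce simp: right_diff_distrib[symmetric])
    qed
  qed
  also have "\<dots> = y \<bullet> ((LINT l|\<mu>. g x l *\<^sub>R S l) *v y)"
    by (rule density_integral_form(2)[OF x S, symmetric])
  finally show ?thesis .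
qed

end

section \<open>The decay inequality at sample points\<close>

text \<open>
  The difference of the two values is the form at \<open>y' - y\<close> and \<open>y' + y\<close>.
\<close>

lemma psd_form_perturb:
  assumes X: "psd X" and b: "\<And>x. norm (X *v x) \<le> s * norm x" and "0 \<le> s"
    and y: "norm y \<le> r" "norm y' \<le> r" and d: "norm (y' - y) \<le> d"
  shows "y' \<bullet> (X *v y') \<le> y \<bullet> (X *v y) + 2 * s * r * d"
proof -
  have "y' \<bullet> (X *v y') - y \<bullet> (X *v y) = (y' - y) \<bullet> (X *v (y' + y))"
    using psd_inner_commute[OF X, of y y'] by (simp add: matrix_vector_right_distrib inner_diff_left inner_add_right)
  also have "\<dots> \<le> norm (y' - y) * norm (X *v (y' + y))"
    by (rule norm_cauchy_schwarz)
  also have "\<dots> \<le> d * (s * (r + r))"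
  proof (intro mult_mono d)
    show "norm (X *v (y' + y)) \<le> s * (r + r)"
      using b[of "y' + y"] mult_left_mono[OF order.trans[OF norm_triangle_ineq add_mono[OF y(2,1)]] \<open>0 \<le> s\<close>]
      by linarith
    show "0 \<le> d" using d norm_ge_zero order.trans by blast
  qed simp
  finally show ?thesis by (simp add: algebra_simps)
qed

lemma closed_loop_form:
  fixes S V G :: "real^'n^'n"
  assumes "psd (S - transpose G ** V ** G - mat \<epsilon>)"
  shows "\<epsilon> * (x \<bullet> x) \<le> x \<bullet> (S *v x) - (G *v x) \<bullet> (V *v (G *v x))"
proof -
  have "x \<bullet> ((transpose G ** V ** G) *v x) = (G *v x) \<bullet> (V *v (G *v x))"
    by (simp add: matrix_vector_mul_assoc[symmetric] dot_lmul_matrix[symmetric] transpose_transpose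
        flip: transpose_matrix_vector)
  moreover have "0 \<le> x \<bullet> ((S - transpose G ** V ** G - mat \<epsilon>) *v x)"
    using assms by (simp add: psd_def)
  ultimately show ?thesis
    by (simp add: matrix_vector_mult_diff_rdistrib inner_diff_right mat_mult_vec)
qed

context cells
begin

text \<open>
  This is how an almost sure statement is evaluated inside a cell: at some point of the cell, which
  may differ from its sample point.
\<close>

lemma not_null_imp_exists:
  assumes "\<not> (AE x in \<mu>. x \<notin> B i)" "AE x in \<mu>. P x"
  obtains x where "x \<in> B i" "P x"
proof (rule ccontr)
  assume "\<not> thesis"
  then have *: "\<And>x. P x \<Longrightarrow> x \<notin> B i" using that by blast
  from assms(2) have "AE x in \<mu>. x \<notin> B i" by eventually_elim (rule *)
  then show False using assms(1) by blast
qed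

text \<open>
  On null cells both weights vanish, so \<open>f\<close> needs no bound there.
\<close>

lemma cell_weighted_sum_change:
  assumes x: "x \<in> M" and y: "y \<in> M" and "0 \<le> k"
    and f: "\<And>j. j < N \<Longrightarrow> \<not> (AE l in \<mu>. l \<notin> B j) \<Longrightarrow> \<bar>f j\<bar> \<le> k"
    and d: "L2_set (\<lambda>j. sqrt (w j x) - sqrt (w j y)) {..<N} \<le> d"
  shows "(\<Sum>j<N. w j y * f j) \<le> (\<Sum>j<N. w j x * f j) + 2 * k * d"
proof -
  have "w j y * f j - w j x * f j \<le> \<bar>w j x - w j y\<bar> * k" if "j < N" for j
  proof (cases "AE l in \<mu>. l \<notin> B j")
    case True
    then show ?thesis by (simp add: cell_weight_null)
  next
    case False
    have "w j y * f j - w j x * f j \<le> \<bar>w j y - w j x\<bar> * \<bar>f j\<bar>"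
      by (metis abs_ge_self abs_mult left_diff_distrib)
    also have "\<dots> \<le> \<bar>w j y - w j x\<bar> * k"
      using f[OF that False] by (intro mult_left_mono) auto
    finally show ?thesis by (simp add: abs_minus_commute)
  qed
  then have "(\<Sum>j<N. w j y * f j - w j x * f j) \<le> (\<Sum>j<N. \<bar>w j x - w j y\<bar> * k)"
    by (intro sum_mono) simp
  also have "\<dots> = k * (\<Sum>j<N. \<bar>w j x - w j y\<bar>)"
    by (simp add: sum_distrib_left mult.commute)
  also have "\<dots> \<le> k * (2 * d)"
    using cell_weight_L1_le[OF x y] d \<open>0 \<le> k\<close> by (intro mult_left_mono) auto
  finally show ?thesis by (simp add: sum_subtractf)
qed

lemma cell_value_bound:
  assumes "\<not> (AE x in \<mu>. x \<notin> B j)" "AE x in \<mu>. opnorm (P x) \<le> s" "AE x in \<mu>. opnorm (P x - Pa x) < \<eta>"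
    and "\<And>x. x \<in> B j \<Longrightarrow> Pa x = Pb"
  shows "norm (Pb *v v) \<le> (s + \<eta>) * norm v"
proof -
  obtain x where x: "x \<in> B j" "opnorm (P x) \<le> s" "opnorm (P x - Pa x) < \<eta>"
    using not_null_imp_exists[OF assms(1) AE_conjI[OF assms(2,3)]] by blast
  have "norm (P x *v v - (P x - Pb) *v v) \<le> norm (P x *v v) + norm ((P x - Pb) *v v)"
    by (rule norm_triangle_ineq4)
  also have "\<dots> \<le> s * norm v + \<eta> * norm v"
    using x assms(4) by (intro add_mono norm_mult_vec_le) auto
  finally show ?thesis
    by (simp add: matrix_vector_mult_diff_rdistrib algebra_simps)
qed

text \<open>
  The decay inequality at a point \<open>x\<close> of the cell, moved to the sample point \<open>c\<close>. The terms of the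
  loss are: \<open>\<eta>\<close> for replacing \<open>S x\<close> by \<open>Sb i\<close>; \<open>\<eta> * \<gamma>\<^sup>2\<close> for replacing \<open>S\<close> by \<open>Sa\<close> under the integral;
  \<open>\<eta> * \<gamma>\<^sup>2 * 2 * (s + 1)\<close> for replacing the weights at \<open>x\<close> by those at \<open>c\<close>; and the last term for
  replacing the closed loop matrix at \<open>x\<close>, whose change is at most \<open>\<eta> * (l + 2 + k)\<close>. The number \<open>\<gamma>\<close>
  bounds both closed loop matrices.
\<close>

lemma cell_decay:
  fixes S Sa A :: "real^'p \<Rightarrow> real^'n^'n" and L La :: "real^'p \<Rightarrow> real^'r^'n"
    and C :: "real^'p \<Rightarrow> real^'n^'r" and c :: "real^'p"
  assumes i: "i < N" and c: "c \<in> B i" and not_null: "\<not> (AE x in \<mu>. x \<notin> B i)"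
    and S: "S \<in> borel_measurable \<mu>" "AE x in \<mu>. opnorm (S x) \<le> s"
    and L: "AE x in \<mu>. opnorm (L x) \<le> l"
    and S_close: "AE x in \<mu>. opnorm (S x - Sa x) < \<eta>"
    and L_close: "AE x in \<mu>. opnorm (L x - La x) < \<eta>"
    and pc: "\<And>j x. j < N \<Longrightarrow> x \<in> B j \<Longrightarrow> Sa x = Sb j" "\<And>j x. j < N \<Longrightarrow> x \<in> B j \<Longrightarrow> La x = Lb j"
    and Sb: "\<And>j. j < N \<Longrightarrow> pos_def (Sb j)"
    and A: "\<And>x v. x \<in> M \<Longrightarrow> norm (A x *v v) \<le> a * norm v"
    and C: "\<And>x v. x \<in> M \<Longrightarrow> norm (C x *v v) \<le> k * norm v"
    and sample: "AE x in \<mu>. x \<in> B i \<longrightarrow> opnorm (vstack (A x) (C x) - vstack (A c) (C c)) < \<eta>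
        \<and> L2_set (\<lambda>j. sqrt (w j x) - sqrt (w j c)) {..<N} < \<eta>"
    and decay: "AE x in \<mu>. psd (S x - transpose (A x + L x ** C x)
          ** (LINT l|\<mu>. g x l *\<^sub>R S l) ** (A x + L x ** C x) - mat \<epsilon>)"
    and pos: "0 \<le> s" "0 \<le> l" "0 \<le> a" "0 \<le> k" "0 < \<eta>" "\<eta> \<le> 1"
  defines "\<gamma> \<equiv> a + (l + 1) * k"
  shows "(\<epsilon> - \<eta> * (1 + \<gamma>\<^sup>2 * (1 + 2 * (s + 1)) + 2 * (s + 1) * \<gamma> * (l + 2 + k))) * (v \<bullet> v)
     \<le> v \<bullet> (Sb i *v v)
       - ((A c + Lb i ** C c) *v v) \<bullet> ((\<Sum>j<N. w j c *\<^sub>R Sb j) *v ((A c + Lb i ** C c) *v v))"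
    and "norm ((A c + Lb i ** C c) *v v) \<le> \<gamma> * norm v"
proof -
  have cM: "c \<in> M" using c i cell_subset by blast
  obtain x where xB: "x \<in> B i" and "opnorm (L x) \<le> l" and Sx: "opnorm (S x - Sa x) < \<eta>"
    and Lx: "opnorm (L x - La x) < \<eta>"
    and ACx: "opnorm (vstack (A x) (C x) - vstack (A c) (C c)) < \<eta>"
    and wx: "L2_set (\<lambda>j. sqrt (w j x) - sqrt (w j c)) {..<N} < \<eta>"
    and dx: "psd (S x - transpose (A x + L x ** C x)
          ** (LINT l|\<mu>. g x l *\<^sub>R S l) ** (A x + L x ** C x) - mat \<epsilon>)"
    using not_null_imp_exists[OF not_null AE_conjI[OF L AE_conjI[OF S_close AE_conjI[OF L_close
      AE_conjI[OF sample decay]]]]] by blast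
  have xM: "x \<in> M" using xB i cell_subset by blast
  define G Gx where "G = A c + Lb i ** C c" and "Gx = A x + L x ** C x"
  define W V where "W = (\<Sum>j<N. w j c *\<^sub>R Sb j)" and "V = (LINT l|\<mu>. g x l *\<^sub>R S l)"
  define y y' where "y = Gx *v v" and "y' = G *v v"
  note Lb = cell_value_bound[OF not_null L L_close pc(2)[OF i]]
  have Lb1: "norm (Lb i *v u) \<le> (l + 1) * norm u" for u
    using Lb[of u] mult_right_mono[of "l + \<eta>" "l + 1" "norm u"] pos by auto
  have Sb1: "norm (Sb j *v u) \<le> (s + 1) * norm u" if "j < N" "\<not> (AE x in \<mu>. x \<notin> B j)" for j u
    using cell_value_bound[OF that(2) S(2) S_close pc(1)[OF that(1)], of u]
      mult_right_mono[of "s + \<eta>" "s + 1" "norm u"] pos by auto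
  have W_bound: "norm (W *v u) \<le> (s + 1) * norm u" for u
    unfolding W_def using cM pos cell_weight_null Sb1
    by (intro norm_weighted_sum_le) (auto simp: cell_weight_nonneg cell_weight_sum)
  have psdW: "psd W"
    unfolding W_def using Sb cM by (intro psd_weighted_sum pos_def_imp_psd) (auto simp: cell_weight_nonneg)
  have y_eq: "y = A x *v v + L x *v (C x *v v)" and y'_eq: "y' = A c *v v + Lb i *v (C c *v v)"
    by (simp_all add: y_def y'_def G_def Gx_def matrix_vector_mult_add_rdistrib matrix_vector_mul_assoc)
  have \<gamma>0: "0 \<le> \<gamma>" using pos by (simp add: \<gamma>_def)
  have y_bound: "norm y \<le> \<gamma> * norm v"
  proof -
    have "norm (L x *v (C x *v v)) \<le> l * (k * norm v)"
      using norm_mult_vec_le[OF \<open>opnorm (L x) \<le> l\<close>, of "C x *v v"] mult_left_mono[OF C[OF xM, of v] pos(2)]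
      by linarith
    also have "\<dots> \<le> (l + 1) * (k * norm v)"
      using pos by (intro mult_right_mono) auto
    finally show ?thesis
      using A[OF xM, of v] norm_triangle_ineq[of "A x *v v" "L x *v (C x *v v)"]
      by (simp add: y_eq \<gamma>_def algebra_simps)
  qed
  show y'_bound: "norm ((A c + Lb i ** C c) *v v) \<le> \<gamma> * norm v"
  proof -
    have "norm (Lb i *v (C c *v v)) \<le> (l + 1) * (k * norm v)"
      using Lb1[of "C c *v v"] mult_left_mono[OF C[OF cM, of v], of "l + 1"] pos
      by linarith
    then show ?thesis
      using A[OF cM, of v] norm_triangle_ineq[of "A c *v v" "Lb i *v (C c *v v)"]
      unfolding G_def[symmetric] y'_def[symmetric]
      by (simp add: y'_eq \<gamma>_def algebra_simps)
  qed
  have diff: "norm (y' - y) \<le> \<eta> * (l + 2 + k) * norm v"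
  proof -
    have AC: "norm ((A x - A c) *v v) \<le> \<eta> * norm v" "norm ((C x - C c) *v v) \<le> \<eta> * norm v"
      using norm_vstack_parts[of "A x - A c" "C x - C c" \<eta> v] ACx by (simp_all add: vstack_diff)
    have "norm (Lb i *v ((C x - C c) *v v)) \<le> (l + 1) * (\<eta> * norm v)"
      using Lb1[of "(C x - C c) *v v"] mult_left_mono[OF AC(2), of "l + 1"] pos by linarith
    moreover have "norm ((L x - Lb i) *v (C x *v v)) \<le> \<eta> * (k * norm v)"
    proof -
      have "opnorm (L x - Lb i) \<le> \<eta>" using Lx pc(2)[OF i xB] by simp
      from norm_mult_vec_le[OF this, of "C x *v v"] show ?thesis
        using mult_left_mono[OF C[OF xM, of v], of \<eta>] pos by linarith
    qed
    moreover have "y - y' = (A x - A c) *v v + (Lb i *v ((C x - C c) *v v) + (L x - Lb i) *v (C x *v v))"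
      by (simp add: y_eq y'_eq matrix_vector_mult_diff_rdistrib matrix_vector_mult_diff_distrib)
    then have "norm (y - y') \<le> norm ((A x - A c) *v v)
        + (norm (Lb i *v ((C x - C c) *v v)) + norm ((L x - Lb i) *v (C x *v v)))"
      by (simp only:) (rule order.trans[OF norm_triangle_ineq add_left_mono[OF norm_triangle_ineq]])
    ultimately show ?thesis
      using AC(1) by (simp add: norm_minus_commute algebra_simps)
  qed
  have vv: "norm v * norm v = v \<bullet> v"
    by (simp add: power2_norm_eq_inner[symmetric] power2_eq_square)
  have "y' \<bullet> (W *v y') \<le> y \<bullet> (W *v y) + 2 * (s + 1) * (\<gamma> * norm v) * (\<eta> * (l + 2 + k) * norm v)"
    using pos y'_bound by (intro psd_form_perturb psdW W_bound y_bound diff) (auto simp: y'_def G_def)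
  then have s1: "y' \<bullet> (W *v y') \<le> y \<bullet> (W *v y) + \<eta> * (2 * (s + 1) * \<gamma> * (l + 2 + k)) * (v \<bullet> v)"
    unfolding vv[symmetric] by (simp add: ac_simps)
  have y2: "y \<bullet> y \<le> \<gamma>\<^sup>2 * (v \<bullet> v)"
    using power_mono[OF y_bound norm_ge_zero, of 2] by (simp add: power_mult_distrib power2_norm_eq_inner)
  have "y \<bullet> (W *v y) = (\<Sum>j<N. w j c * (y \<bullet> (Sb j *v y)))"
    by (simp add: W_def matrix_sum_mult inner_sum_right scaleR_matrix_vector_assoc[symmetric])
  also have "\<dots> \<le> (\<Sum>j<N. w j x * (y \<bullet> (Sb j *v y))) + 2 * ((s + 1) * (y \<bullet> y)) * \<eta>"
  proof (rule cell_weighted_sum_change[OF xM cM])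
    show "\<bar>y \<bullet> (Sb j *v y)\<bar> \<le> (s + 1) * (y \<bullet> y)" if "j < N" "\<not> (AE l in \<mu>. l \<notin> B j)" for j
      using inner_matrix_le_of_bound[OF Sb1[OF that]] pos_def_imp_psd[OF Sb[OF that(1)]] by (simp add: psd_def)
  qed (use wx pos in auto)
  finally have s2: "y \<bullet> (W *v y) \<le> (\<Sum>j<N. w j x * (y \<bullet> (Sb j *v y))) + \<eta> * (2 * (s + 1)) * (y \<bullet> y)"
    by (simp add: algebra_simps)
  have s3: "(\<Sum>j<N. w j x * (y \<bullet> (Sb j *v y))) - \<eta> * (y \<bullet> y) \<le> y \<bullet> (V *v y)"
    unfolding V_def by (rule density_integral_lower_bound[OF xM S S_close pc(1)])
  have s4: "\<epsilon> * (v \<bullet> v) \<le> v \<bullet> (S x *v v) - y \<bullet> (V *v y)"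
    using closed_loop_form[OF dx, of v] by (simp add: y_def Gx_def V_def)
  have s5: "v \<bullet> (S x *v v) \<le> v \<bullet> (Sb i *v v) + \<eta> * (v \<bullet> v)"
    using Sx pc(1)[OF i xB] by (intro form_diff_le) simp
  have s6: "\<eta> * (1 + 2 * (s + 1)) * (y \<bullet> y) \<le> \<eta> * (1 + 2 * (s + 1)) * (\<gamma>\<^sup>2 * (v \<bullet> v))"
    using pos by (intro mult_left_mono y2) auto
  have "(\<epsilon> - \<eta> * (1 + \<gamma>\<^sup>2 * (1 + 2 * (s + 1)) + 2 * (s + 1) * \<gamma> * (l + 2 + k))) * (v \<bullet> v)
     = \<epsilon> * (v \<bullet> v) - \<eta> * (v \<bullet> v) - \<eta> * (1 + 2 * (s + 1)) * (\<gamma>\<^sup>2 * (v \<bullet> v)) - \<eta> * (2 * (s + 1) * \<gamma> * (l + 2 + k)) * (v \<bullet> v)"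
    by (simp add: algebra_simps)
  moreover have "\<eta> * (1 + 2 * (s + 1)) * (y \<bullet> y) = \<eta> * (y \<bullet> y) + \<eta> * (2 * (s + 1)) * (y \<bullet> y)"
    by (simp add: algebra_simps)
  ultimately have "(\<epsilon> - \<eta> * (1 + \<gamma>\<^sup>2 * (1 + 2 * (s + 1)) + 2 * (s + 1) * \<gamma> * (l + 2 + k))) * (v \<bullet> v)
     \<le> v \<bullet> (Sb i *v v) - y' \<bullet> (W *v y')"
    using s1 s2 s3 s4 s5 s6 by linarith
  then show "(\<epsilon> - \<eta> * (1 + \<gamma>\<^sup>2 * (1 + 2 * (s + 1)) + 2 * (s + 1) * \<gamma> * (l + 2 + k))) * (v \<bullet> v)
     \<le> v \<bullet> (Sb i *v v)
       - ((A c + Lb i ** C c) *v v) \<bullet> ((\<Sum>j<N. w j c *\<^sub>R Sb j) *v ((A c + Lb i ** C c) *v v))"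
    by (simp add: y'_def G_def W_def)
qed

end

section \<open>Feasibility\<close>

text \<open>
  Provides the resolution \<open>\<eta>\<close> of the partition, chosen before the partition and its matrices.
\<close>

lemma small_common_factor:
  fixes b :: real
  assumes "0 < b" "0 \<le> K1" "0 \<le> K2" "0 \<le> K3"
  obtains \<eta> where "0 < \<eta>" "\<eta> \<le> 1" "\<eta> * K1 \<le> b" "\<eta> * K2 \<le> b" "\<eta> * K3 \<le> b"
proof -
  define K where "K = K1 + K2 + K3 + 1"
  define \<eta> where "\<eta> = min 1 (b / K)"
  have "0 < K" using assms by (simp add: K_def)
  have \<eta>: "0 < \<eta>" "\<eta> \<le> 1" using assms \<open>0 < K\<close> by (auto simp: \<eta>_def)
  have "\<eta> * X \<le> b" if "X \<le> K" for X
  proof -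
    have "\<eta> * X \<le> \<eta> * K" using \<eta> that by (intro mult_left_mono) auto
    also have "\<dots> \<le> b / K * K" using \<open>0 < K\<close> by (intro mult_right_mono) (auto simp: \<eta>_def)
    finally show ?thesis using \<open>0 < K\<close> by simp
  qed
  then show thesis using \<eta> assms by (intro that) (auto simp: K_def)
qed

lemma pos_def_mat: "0 < k \<Longrightarrow> pos_def (mat k :: real^'n^'n)"
  by (simp add: pos_def_def mat_mult_vec transpose_mat)

theorem proposition5p11:
  fixes \<tau>min \<tau>max :: real
    and M :: "(real^'p) set"
    and \<mu> :: "(real^'p) measure"
    and g :: "real^'p \<Rightarrow> real^'p \<Rightarrow> real"
    and A :: "real^'p \<Rightarrow> real^'n^'n"
    and C :: "real^'p \<Rightarrow> real^'n^'r"
  assumes "\<tau>min \<le> \<tau>max"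
    and "M = cbox (\<chi> k. \<tau>min) (\<chi> k. \<tau>max)"
    and "sets \<mu> = sets (restrict_space borel M)"
    and "sigma_finite_measure \<mu>"
    and "transition_density \<mu> g"
    and "A \<in> H_sup \<mu>"
    and "C \<in> H_sup \<mu>"
    and I: "\<forall>c\<in>M. \<forall>\<delta>>0. emeasure \<mu> {\<phi>\<in>M. norm (\<phi> - c) < \<delta>} > 0"
    and II: "continuous_on M A" "continuous_on M C"
    and III: "\<exists>(S :: real^'p \<Rightarrow> real^'n^'n) (L :: real^'p \<Rightarrow> real^'r^'n) \<epsilon>.
      S \<in> H_sup_psd \<mu> \<and> L \<in> H_sup \<mu> \<and> \<epsilon> > 0 \<and>
      (AE \<phi> in \<mu>. psd (S \<phi> - transpose (A \<phi> + L \<phi> ** C \<phi>)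
          ** (LINT l|\<mu>. g \<phi> l *\<^sub>R S l) ** (A \<phi> + L \<phi> ** C \<phi>) - mat \<epsilon>)) \<and>
      (\<forall>\<epsilon>a>0. \<forall>\<epsilon>b>0. \<exists>N B c Sa La Sb Lb.
        box_partition M N B \<and> (\<forall>i<N. c i \<in> B i) \<and>
        Sa \<in> H_sup_psd \<mu> \<and> La \<in> H_sup \<mu> \<and>
        (\<forall>i<N. pos_def (Sb i) \<and> (\<forall>\<phi>\<in>B i. Sa \<phi> = Sb i \<and> La \<phi> = Lb i)) \<and>
        sup_norm \<mu> (\<lambda>\<phi>. S \<phi> - Sa \<phi>) < ereal \<epsilon>a \<and>
        sup_norm \<mu> (\<lambda>\<phi>. L \<phi> - La \<phi>) < ereal \<epsilon>a \<and>
        (\<forall>i<N. \<forall>j<N. continuous (at (c i) within M) (cell_weight \<mu> g B j)) \<and>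
        (\<forall>i<N. AE \<phi> in \<mu>. \<phi> \<in> B i \<longrightarrow>
          opnorm (vstack (A \<phi>) (C \<phi>) - vstack (A (c i)) (C (c i))) < \<epsilon>b \<and>
          L2_set (\<lambda>j. sqrt (cell_weight \<mu> g B j \<phi>) - sqrt (cell_weight \<mu> g B j (c i))) {..<N} < \<epsilon>b))"
  shows "\<exists>N B c \<kappa>A \<kappa>w.
    box_partition M N B \<and>
    (\<forall>i<N. c i \<in> B i \<and> \<kappa>A i > 0 \<and> \<kappa>w i > 0) \<and>
    (\<forall>i<N. AE \<phi> in \<mu>. \<phi> \<in> B i \<longrightarrow>
      opnorm (vstack (A \<phi>) (C \<phi>) - vstack (A (c i)) (C (c i))) \<le> \<kappa>A i \<and>
      ix_opnorm (UNIV :: 'n set) (stacked N)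
        (\<lambda>a b. sqrt_weight_row (cell_weight \<mu> g B) \<phi> a b
             - sqrt_weight_row (cell_weight \<mu> g B) (c i) a b) \<le> \<kappa>w i) \<and>
    (\<exists>(S :: nat \<Rightarrow> real^'n^'n) (U :: nat \<Rightarrow> real^'n^'n) (L :: nat \<Rightarrow> real^'r^'n) lam rho.
      \<forall>i<N. pos_def (S i) \<and> lam i > 0 \<and> rho i > 0 \<and>
        ix_pos_def (lmi_indices N)
          (lmi_matrix N (A (c i)) (C (c i)) (sqrt_weight_row (cell_weight \<mu> g B) (c i))
            (\<kappa>A i) (\<kappa>w i) S (S i) (U i) (L i) (lam i) (rho i)))"
proof -
  have "compact M" by (simp add: assms(2))
  obtain a where a: "0 \<le> a" "\<And>x v. x \<in> M \<Longrightarrow> norm (A x *v v) \<le> a * norm v"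
    using continuous_matrix_bounded[OF \<open>compact M\<close> II(1)] by blast
  obtain k where k: "0 \<le> k" "\<And>x v. x \<in> M \<Longrightarrow> norm (C x *v v) \<le> k * norm v"
    using continuous_matrix_bounded[OF \<open>compact M\<close> II(2)] by blast
  obtain S :: "real^'p \<Rightarrow> real^'n^'n" and L :: "real^'p \<Rightarrow> real^'r^'n" and \<epsilon> where
    S: "S \<in> H_sup_psd \<mu>" and L: "L \<in> H_sup \<mu>" and \<epsilon>: "\<epsilon> > 0"
    and decay: "AE \<phi> in \<mu>. psd (S \<phi> - transpose (A \<phi> + L \<phi> ** C \<phi>)
          ** (LINT l|\<mu>. g \<phi> l *\<^sub>R S l) ** (A \<phi> + L \<phi> ** C \<phi>) - mat \<epsilon>)"
    and approx: "\<forall>\<epsilon>a>0. \<forall>\<epsilon>b>0. \<exists>N B c Sa La Sb Lb.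
        box_partition M N B \<and> (\<forall>i<N. c i \<in> B i) \<and>
        Sa \<in> H_sup_psd \<mu> \<and> La \<in> H_sup \<mu> \<and>
        (\<forall>i<N. pos_def (Sb i) \<and> (\<forall>\<phi>\<in>B i. Sa \<phi> = Sb i \<and> La \<phi> = Lb i)) \<and>
        sup_norm \<mu> (\<lambda>\<phi>. S \<phi> - Sa \<phi>) < ereal \<epsilon>a \<and>
        sup_norm \<mu> (\<lambda>\<phi>. L \<phi> - La \<phi>) < ereal \<epsilon>a \<and>
        (\<forall>i<N. \<forall>j<N. continuous (at (c i) within M) (cell_weight \<mu> g B j)) \<and>
        (\<forall>i<N. AE \<phi> in \<mu>. \<phi> \<in> B i \<longrightarrow>
          opnorm (vstack (A \<phi>) (C \<phi>) - vstack (A (c i)) (C (c i))) < \<epsilon>b \<and>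
          L2_set (\<lambda>j. sqrt (cell_weight \<mu> g B j \<phi>) - sqrt (cell_weight \<mu> g B j (c i))) {..<N} < \<epsilon>b)"
    using III by blast
  have S_meas: "S \<in> borel_measurable \<mu>" and "S \<in> H_sup \<mu>"
    using S by (auto simp: H_sup_psd_def H_sup_def)
  obtain s where s: "0 \<le> s" "AE x in \<mu>. opnorm (S x) \<le> s"
    using H_sup_bound[OF \<open>S \<in> H_sup \<mu>\<close>] by blast
  obtain l where l: "0 \<le> l" "AE x in \<mu>. opnorm (L x) \<le> l"
    using H_sup_bound[OF L] by blast
  define \<gamma> where "\<gamma> = a + (l + 1) * k"
  \<comment> \<open>Multiple of the identity used on null cells: it dominates the closed loop form with gain zero,
    with margin \<open>\<epsilon>\<close>.\<close>
  define sN where "sN = (s + 1) * a\<^sup>2 + \<epsilon>"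
  define sb where "sb = s + 1 + sN"
  \<comment> \<open>\<open>lam + \<beta> * \<gamma>\<^sup>2\<close> stays below half of the margin \<open>\<epsilon> / 2\<close>; \<open>rho\<close> and \<open>t\<close> each use up a quarter
    of \<open>\<beta>\<close>. None of them depends on the partition.\<close>
  define lam where "lam = \<epsilon> / 8"
  define \<beta> where "\<beta> = \<epsilon> / (8 * (\<gamma>\<^sup>2 + 1))"
  define rho where "rho = \<beta> / 4"
  define t where "t = \<beta> / (4 * sb)"
  \<comment> \<open>Factors of \<open>\<eta>\<close> in the loss of the decay inequality and, since \<open>\<eta>\<^sup>2 \<le> \<eta>\<close>, in \<open>c2\<close> and \<open>c3\<close>.\<close>
  define K1 where "K1 = 1 + \<gamma>\<^sup>2 * (1 + 2 * (s + 1)) + 2 * (s + 1) * \<gamma> * (l + 2 + k)"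
  define K2 where "K2 = 2 * ((sb + \<beta>) * (1 + (l + 1)))\<^sup>2 / lam"
  define K3 where "K3 = (1 + 1 / t) * sb"
  have \<gamma>: "0 \<le> \<gamma>" "a \<le> \<gamma>" using a l k by (simp_all add: \<gamma>_def)
  have sN: "0 < sN" using s \<epsilon> by (simp add: sN_def add_nonneg_pos)
  have sb: "0 < sb" using s sN by (simp add: sb_def)
  have g1: "0 < \<gamma>\<^sup>2 + 1" by (simp add: add_nonneg_pos)
  have lam: "0 < lam" and \<beta>: "0 < \<beta>" using \<epsilon> g1 by (simp_all add: lam_def \<beta>_def)
  have rho: "0 < rho" and t: "0 < t" using \<beta> sb by (simp_all add: rho_def t_def)
  have K: "0 \<le> K1" "0 \<le> K2" "0 \<le> K3"
    using \<gamma> s l k lam t sb by (simp_all add: K1_def K2_def K3_def)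
  obtain \<eta> where \<eta>: "0 < \<eta>" "\<eta> \<le> 1" and \<eta>K: "\<eta> * K1 \<le> min (\<epsilon> / 2) (\<beta> / 8)"
    "\<eta> * K2 \<le> min (\<epsilon> / 2) (\<beta> / 8)" "\<eta> * K3 \<le> min (\<epsilon> / 2) (\<beta> / 8)"
    using small_common_factor[of "min (\<epsilon> / 2) (\<beta> / 8)" K1 K2 K3] K \<epsilon> \<beta> by auto
  have \<eta>2: "\<eta>\<^sup>2 * X \<le> \<eta> * X" if "0 \<le> X" for X
    using \<eta> that by (intro mult_right_mono) (auto simp: power2_eq_square mult_left_le)
  have "\<epsilon> / (8 * q) * q = \<epsilon> / 8" if "0 < q" for q
    using that by simp
  from this[OF g1] have "\<beta> * (\<gamma>\<^sup>2 + 1) = \<epsilon> / 8" by (simp only: \<beta>_def)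
  then have c1: "lam + \<beta> * \<gamma>\<^sup>2 < \<epsilon> / 2" using \<epsilon> \<beta> by (simp add: lam_def algebra_simps)
  have "t * sb = \<beta> / 4" using sb by (simp add: t_def)
  moreover have "2 * \<eta>\<^sup>2 * ((sb + \<beta>) * (1 + (l + 1)))\<^sup>2 / lam = \<eta>\<^sup>2 * K2" by (simp add: K2_def)
  ultimately have c2: "t * sb + rho + 2 * \<eta>\<^sup>2 * ((sb + \<beta>) * (1 + (l + 1)))\<^sup>2 / lam < \<beta>"
    using \<eta>2[OF K(2)] \<eta>K(2) \<beta> by (simp add: rho_def)
  have "(1 + 1 / t) * \<eta>\<^sup>2 * sb = \<eta>\<^sup>2 * K3" by (simp add: K3_def)
  also have "\<dots> < rho"
    using \<eta>2[OF K(3)] \<eta>K(3) \<beta> by (simp add: rho_def)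
  finally have c3: "(1 + 1 / t) * \<eta>\<^sup>2 * sb < rho" .
  obtain N B c Sa La Sb Lb where part: "box_partition M N B" and c: "\<And>i. i < N \<Longrightarrow> c i \<in> B i"
    and pc: "\<And>i \<phi>. i < N \<Longrightarrow> \<phi> \<in> B i \<Longrightarrow> Sa \<phi> = Sb i" "\<And>i \<phi>. i < N \<Longrightarrow> \<phi> \<in> B i \<Longrightarrow> La \<phi> = Lb i"
    and Sb: "\<And>i. i < N \<Longrightarrow> pos_def (Sb i)"
    and close: "sup_norm \<mu> (\<lambda>\<phi>. S \<phi> - Sa \<phi>) < ereal \<eta>" "sup_norm \<mu> (\<lambda>\<phi>. L \<phi> - La \<phi>) < ereal \<eta>"
    and sample: "\<And>i. i < N \<Longrightarrow> AE \<phi> in \<mu>. \<phi> \<in> B i \<longrightarrow>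
          opnorm (vstack (A \<phi>) (C \<phi>) - vstack (A (c i)) (C (c i))) < \<eta> \<and>
          L2_set (\<lambda>j. sqrt (cell_weight \<mu> g B j \<phi>) - sqrt (cell_weight \<mu> g B j (c i))) {..<N} < \<eta>"
    using approx[rule_format, OF \<eta>(1) \<eta>(1)]
    apply (elim exE conjE)
    subgoal for N B c Sa La Sb Lb by (rule that[of N B c Sa Sb La Lb]) simp_all
    done
  interpret cells M \<mu> g N B
    by unfold_locales (fact assms part)+
  note S_close = AE_opnorm_less[OF close(1)] and L_close = AE_opnorm_less[OF close(2)]
  have cM: "c i \<in> M" if "i < N" for i using c cell_subset that by blast
  define null where "null i \<longleftrightarrow> (AE x in \<mu>. x \<notin> B i)" for i
  define S' where "S' i = (if null i then mat sN else Sb i)" for i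
  define L' where "L' i = (if null i then 0 else Lb i)" for i
  define W where "W i = (\<Sum>j<N. w j (c i) *\<^sub>R S' j)" for i
  define U where "U i = W i + mat \<beta>" for i
  have S'_pd: "pos_def (S' i)" if "i < N" for i
    using that by (auto simp: S'_def intro: pos_def_mat[OF sN] Sb)
  have Sb1: "norm (Sb i *v v) \<le> (s + 1) * norm v" if "i < N" "\<not> null i" for i v
    using cell_value_bound[OF that(2)[unfolded null_def] s(2) S_close pc(1)[OF that(1)], of v]
      mult_right_mono[of "s + \<eta>" "s + 1" "norm v"] \<eta> by auto
  have S'_bound: "norm (S' i *v v) \<le> sb * norm v" if "i < N" for i v
  proof (cases "null i")
    case True
    then show ?thesis using s sN by (simp add: S'_def sb_def mat_mult_vec mult_right_mono)
  next
    case False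
    then show ?thesis
      using Sb1[OF that False, of v] mult_right_mono[of "s + 1" sb "norm v"] sN by (simp add: S'_def sb_def)
  qed
  have L'_bound: "norm (L' i *v v) \<le> (l + 1) * norm v" if "i < N" for i v
  proof (cases "null i")
    case True
    then show ?thesis using l by (simp add: L'_def)
  next
    case False
    then show ?thesis
      using cell_value_bound[OF False[unfolded null_def] l(2) L_close pc(2)[OF that], of v]
      mult_right_mono[of "l + \<eta>" "l + 1" "norm v"] \<eta> by (auto simp: L'_def)
  qed
  \<comment> \<open>Changing the matrices on null cells is invisible, as their weights vanish.\<close>
  have W_Sb: "W i = (\<Sum>j<N. w j (c i) *\<^sub>R Sb j)" for i
    unfolding W_def S'_def by (intro sum.cong) (auto simp: null_def cell_weight_null)
  have W_bound: "norm (W i *v v) \<le> (s + 1) * norm v" if "i < N" for i v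
    unfolding W_Sb using cM[OF that] s Sb1 cell_weight_null
    by (intro norm_weighted_sum_le) (auto simp: cell_weight_nonneg cell_weight_sum null_def)
  have cell: "norm ((A (c i) + L' i ** C (c i)) *v v) \<le> \<gamma> * norm v \<and>
     \<epsilon> / 2 * (v \<bullet> v) \<le> v \<bullet> (S' i *v v) - ((A (c i) + L' i ** C (c i)) *v v) \<bullet> (W i *v ((A (c i) + L' i ** C (c i)) *v v))"
    if i: "i < N" for i v
  proof (cases "null i")
    case True
    let ?y = "A (c i) *v v"
    have y: "norm ?y \<le> a * norm v" using a cM[OF i] by blast
    have "?y \<bullet> (W i *v ?y) \<le> (s + 1) * (?y \<bullet> ?y)"
      by (rule inner_matrix_le_of_bound[OF W_bound[OF i]])
    also have "\<dots> \<le> (s + 1) * (a\<^sup>2 * (v \<bullet> v))"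
      using s power_mono[OF y norm_ge_zero, of 2]
      by (intro mult_left_mono) (auto simp: power_mult_distrib power2_norm_eq_inner)
    also have "\<dots> = v \<bullet> (S' i *v v) - \<epsilon> * (v \<bullet> v)"
      using True by (simp add: S'_def sN_def mat_mult_vec algebra_simps)
    also have "\<dots> \<le> v \<bullet> (S' i *v v) - \<epsilon> / 2 * (v \<bullet> v)"
      using \<epsilon> by (simp add: mult_right_mono)
    finally show ?thesis
      using True y \<gamma> mult_right_mono[OF \<gamma>(2), of "norm v"] by (simp add: L'_def)
  next
    case False
    note d = cell_decay[where v = v and Sb = Sb and Lb = Lb, OF i c[OF i] False[unfolded null_def] S_meas s(2) l(2) S_close L_close pc Sb a(2) k(2)
      sample[OF i] decay s(1) l(1) a(1) k(1) \<eta>, folded \<gamma>_def, folded K1_def]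
    have "\<epsilon> / 2 * (v \<bullet> v) \<le> (\<epsilon> - \<eta> * K1) * (v \<bullet> v)"
      using \<eta>K(1) by (intro mult_right_mono) auto
    then show ?thesis
      using d False by (simp add: W_Sb S'_def L'_def)
  qed
  have lmi: "ix_pos_def (lmi_indices N) (lmi_matrix N (A (c i)) (C (c i)) (sqrt_weight_row w (c i))
            \<eta> \<eta> S' (S' i) (U i) (U i ** L' i) lam rho)" if i: "i < N" for i
    unfolding U_def W_def
  proof (rule lmi_pos_def[where s = sb and \<gamma> = \<gamma> and l = "l + 1" and e = "\<epsilon> / 2" and t = t])
    show "0 \<le> sb" "0 \<le> l + 1" using sb l by auto
    show "\<epsilon> / 2 * (v \<bullet> v) \<le> v \<bullet> (S' i *v v) - ((A (c i) + L' i ** C (c i)) *v v) \<bullet>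
         ((\<Sum>j<N. w j (c i) *\<^sub>R S' j) *v ((A (c i) + L' i ** C (c i)) *v v))" for v
      using cell[OF i, of v] by (simp add: W_def)
    show "norm ((A (c i) + L' i ** C (c i)) *v v) \<le> \<gamma> * norm v" for v
      using cell[OF i, of v] by blast
  qed (use i S'_pd S'_bound L'_bound cM cell_weight_nonneg cell_weight_sum \<beta> lam rho t c1 c2 c3 in auto)
  have sample': "AE \<phi> in \<mu>. \<phi> \<in> B i \<longrightarrow>
      opnorm (vstack (A \<phi>) (C \<phi>) - vstack (A (c i)) (C (c i))) \<le> \<eta> \<and>
      ix_opnorm (UNIV :: 'n set) (stacked N)
        (\<lambda>a b. sqrt_weight_row w \<phi> a b - sqrt_weight_row w (c i) a b) \<le> \<eta>" if "i < N" for i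
    using sample[OF that]
  proof eventually_elim
    case (elim \<phi>)
    then show ?case
      using sqrt_weight_row_opnorm[where w = w and N = N and x = \<phi> and y = "c i"]
      by (auto intro: less_imp_le order.trans[OF sqrt_weight_row_opnorm])
  qed
  show ?thesis
  proof (intro exI conjI allI impI)
    show "box_partition M N B" by (rule part)
  next
    fix i assume i: "i < N"
    show "c i \<in> B i" by (rule c[OF i])
    show "0 < (\<lambda>_. \<eta>) i" "0 < (\<lambda>_. \<eta>) i" using \<eta> by simp_all
    show "AE \<phi> in \<mu>. \<phi> \<in> B i \<longrightarrow>
      opnorm (vstack (A \<phi>) (C \<phi>) - vstack (A (c i)) (C (c i))) \<le> (\<lambda>_. \<eta>) i \<and>
      ix_opnorm (UNIV :: 'n set) (stacked N)
        (\<lambda>a b. sqrt_weight_row w \<phi> a b - sqrt_weight_row w (c i) a b) \<le> (\<lambda>_. \<eta>) i"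
      using sample'[OF i] by simp
    show "pos_def (S' i)" by (rule S'_pd[OF i])
    show "0 < (\<lambda>_. lam) i" "0 < (\<lambda>_. rho) i" using lam rho by simp_all
    show "ix_pos_def (lmi_indices N) (lmi_matrix N (A (c i)) (C (c i)) (sqrt_weight_row w (c i))
            ((\<lambda>_. \<eta>) i) ((\<lambda>_. \<eta>) i) S' (S' i) (U i) ((\<lambda>i. U i ** L' i) i) ((\<lambda>_. lam) i) ((\<lambda>_. rho) i))"
      using lmi[OF i] by simp
  qed
qed

end
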